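(* Let $\mathbf{k}$ be any algebraically closed field of characteristic $p > 0$. For each integer $n \geq 1$, let $S_n \subseteq \mathbf{Z}$ be the set of integers $e$ such that for every smooth Fano hypersurface $X$ of dimension $n$ over $\mathbf{k}$ there exists a free rational curve $\varphi \colon \mathbf{P}^1 \to X$ of degree $\leq e$. Then $$\limsup_{n \to \infty} \frac{1}{n} \inf S_n = \infty.$$
   Context: A smooth Fano hypersurface of dimension $n$ over $\mathbf{k}$ is a smooth hypersurface $X \subset \mathbf{P}^{n+1}_{\mathbf{k}}$ whose anticanonical bundle is ample, i.e. of degree $d \leq n+1$. A rational curve in $X$ is a nonconstant morphism $\varphi \colon \mathbf{P}^1 \to X$ over $\mathbf{k}$; its degree is the degree of the line bundle $\varphi^*\mathcal{O}_{\mathbf{P}^{n+1}}(1)$ on $\mathbf{P}^1$. It is free if $\mathrm{H}^1(\mathbf{P}^1, \varphi^*\mathcal{T}_X \otimes \mathcal{O}_{\mathbf{P}^1}(-1)) = 0$, where $\mathcal{T}_X$ is the tangent bundle of $X$. The infimum of the empty set is $+\infty$ by convention. *)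

theory Defs
  imports
    Complex_Main
    "HOL-Library.Poly_Mapping"
    "HOL-Library.Extended_Real"
    "HOL-Library.Liminf_Limsup"
    "HOL-Computational_Algebra.Polynomial"
    "HOL-Computational_Algebra.Fraction_Field"
begin

section \<open>Homogeneous polynomials and smooth Fano hypersurfaces\<close>

type_synonym 'a mpoly = "(nat \<Rightarrow>\<^sub>0 nat) \<Rightarrow>\<^sub>0 'a"

definition mpoly_eval ::
    "('a::comm_ring_1 \<Rightarrow> 'b::comm_ring_1) \<Rightarrow> (nat \<Rightarrow> 'b) \<Rightarrow> 'a mpoly \<Rightarrow> 'b" where
  "mpoly_eval h x P =
     (\<Sum>m\<in>Poly_Mapping.keys P. h (Poly_Mapping.lookup P m) *
        (\<Prod>i\<in>Poly_Mapping.keys m. x i ^ Poly_Mapping.lookup m i))"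

definition mpoly_pderiv :: "nat \<Rightarrow> 'a::comm_ring_1 mpoly \<Rightarrow> 'a mpoly" where
  "mpoly_pderiv i P =
     (\<Sum>m\<in>Poly_Mapping.keys P.
        Poly_Mapping.single (m - Poly_Mapping.single i 1)
          (of_nat (Poly_Mapping.lookup m i) * Poly_Mapping.lookup P m))"

text \<open>Homogeneous polynomials of degree \<open>d\<close> (and zero) in the variables of index \<open>< N\<close>.\<close>
definition forms :: "nat \<Rightarrow> nat \<Rightarrow> 'a::comm_ring_1 mpoly set" where
  "forms N d =
     {P. \<forall>m\<in>Poly_Mapping.keys P. Poly_Mapping.keys m \<subseteq> {..<N} \<and>
           (\<Sum>i\<in>Poly_Mapping.keys m. Poly_Mapping.lookup m i) = d}"

text \<open>
  A hypersurface of dimension \<open>n\<close> is given by its equation \<open>F\<close> in the \<open>n + 2\<close> homogeneous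
  coordinates of projective space. Over an algebraically closed field it is smooth iff the
  Jacobian criterion holds at every closed point. The vanishing of \<open>F\<close> itself has to be part of
  the criterion, since Euler's formula does not give it when the characteristic divides the
  degree.  By adjunction the anticanonical bundle is \<open>O(n + 2 - d)\<close>, so that it is ample
  iff \<open>d \<le> n + 1\<close>.
\<close>
definition smooth_hypersurface :: "nat \<Rightarrow> nat \<Rightarrow> 'a::field mpoly \<Rightarrow> bool" where
  "smooth_hypersurface n d F \<longleftrightarrow>
     d \<ge> 1 \<and> F \<noteq> 0 \<and> F \<in> forms (n + 2) d \<and>
     \<not> (\<exists>x. (\<exists>i<n + 2. x i \<noteq> 0) \<and> mpoly_eval id x F = 0 \<and>
          (\<forall>i<n + 2. mpoly_eval id x (mpoly_pderiv i F) = 0))"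

definition smooth_Fano_hypersurface :: "nat \<Rightarrow> 'a::field mpoly \<Rightarrow> bool" where
  "smooth_Fano_hypersurface n F \<longleftrightarrow> (\<exists>d. smooth_hypersurface n d F \<and> d \<le> n + 1)"


section \<open>The projective line\<close>

text \<open>
  On the projective line with homogeneous coordinates \<open>s, t\<close> put \<open>z = s / t\<close>. A global section
  of \<open>O(e)\<close>, i.e. a binary form \<open>\<Sum>j\<le>e. c\<^sub>j s\<^sup>j t\<^sup>e\<^sup>-\<^sup>j\<close>, is encoded by the polynomial
  \<open>\<Sum>j\<le>e. c\<^sub>j z\<^sup>j\<close> of degree at most \<open>e\<close>.
\<close>
datatype 'a P1 = Affine 'a | Infinity

text \<open>The value of a binary form of degree \<open>e\<close> at \<open>(c, 1)\<close>, respectively at \<open>(1, 0)\<close>.\<close>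
definition form_at :: "nat \<Rightarrow> 'a::field poly \<Rightarrow> 'a P1 \<Rightarrow> 'a" where
  "form_at e f v = (case v of Affine c \<Rightarrow> poly f c | Infinity \<Rightarrow> coeff f e)"

text \<open>
  The stalk of \<open>O(m)\<close> at a closed point, for any integer \<open>m\<close>, as a submodule of the function
  field; \<open>O(m)\<close> is trivialized by \<open>t\<^sup>m\<close>, i.e. it is realized as the sheaf of functions with a
  pole of order at most \<open>m\<close> at infinity.
\<close>
definition line_bundle_stalk :: "int \<Rightarrow> 'a::field P1 \<Rightarrow> 'a poly fract set" where
  "line_bundle_stalk m v =
     (case v of
        Affine c \<Rightarrow> {Fract f g | f g. poly g c \<noteq> 0}
      | Infinity \<Rightarrow> {Fract f g | f g. g \<noteq> 0 \<and> (f = 0 \<or> int (degree f) \<le> int (degree g) + m)})"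


section \<open>Rational curves\<close>

abbreviation pullback :: "(nat \<Rightarrow> 'a::field poly) \<Rightarrow> 'a mpoly \<Rightarrow> 'a poly" where
  "pullback \<phi> \<equiv> mpoly_eval (\<lambda>c. [:c:]) \<phi>"

text \<open>
  A morphism from the projective line to projective space such that the pullback of \<open>O(1)\<close> has
  degree \<open>e\<close> is given by \<open>n + 2\<close> binary forms of degree \<open>e\<close> without common zero. The last
  condition says that the morphism is not constant.
\<close>
definition rational_curve :: "nat \<Rightarrow> 'a::field mpoly \<Rightarrow> nat \<Rightarrow> (nat \<Rightarrow> 'a poly) \<Rightarrow> bool" where
  "rational_curve n F e \<phi> \<longleftrightarrow>
     (\<forall>i<n + 2. degree (\<phi> i) \<le> e) \<and>
     (\<forall>v. \<exists>i<n + 2. form_at e (\<phi> i) v \<noteq> 0) \<and>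
     pullback \<phi> F = 0 \<and>
     \<not> (\<exists>x. \<forall>v. \<exists>c. \<forall>i<n + 2. form_at e (\<phi> i) v = c * x i)"


section \<open>The pullback of the tangent bundle\<close>

text \<open>
  Let \<open>X\<close> be the hypersurface \<open>F = 0\<close>, let \<open>\<eta>\<close> be the generic point of the projective line and
  let \<open>\<phi>\<close> be a rational curve. The local ring of \<open>X\<close> at \<open>\<phi>(\<eta>)\<close> consists of the fractions
  \<open>a / b\<close> of forms of the same degree such that \<open>b\<close> does not vanish identically along \<open>\<phi>\<close>.
\<close>
definition local_fractions :: "nat \<Rightarrow> (nat \<Rightarrow> 'a::field poly) \<Rightarrow> ('a mpoly \<times> 'a mpoly) set" where
  "local_fractions n \<phi> =
     {(a, b). \<exists>r. a \<in> forms (n + 2) r \<and> b \<in> forms (n + 2) r \<and> pullback \<phi> b \<noteq> 0}"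

text \<open>Equality of two fractions in this local ring.\<close>
definition same_germ ::
    "nat \<Rightarrow> 'a::field mpoly \<Rightarrow> (nat \<Rightarrow> 'a poly) \<Rightarrow>
      'a mpoly \<times> 'a mpoly \<Rightarrow> 'a mpoly \<times> 'a mpoly \<Rightarrow> bool" where
  "same_germ n F \<phi> = (\<lambda>(a, b) (a', b').
     \<exists>r. \<exists>c\<in>forms (n + 2) r. pullback \<phi> c \<noteq> 0 \<and> F dvd c * (a * b' - a' * b))"

text \<open>
  Derivations over the ground field from the local ring of \<open>X\<close> at \<open>\<phi>(\<eta>)\<close> to the function field
  of the projective line, a module over this local ring by \<open>\<phi>\<close>. They form the stalk at \<open>\<eta>\<close>
  of the pullback of the tangent bundle of \<open>X\<close>. The values of \<open>D\<close> outside \<open>local_fractions\<close>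
  are irrelevant.
\<close>
definition derivation_along ::
    "nat \<Rightarrow> 'a::field mpoly \<Rightarrow> (nat \<Rightarrow> 'a poly) \<Rightarrow>
      ('a mpoly \<times> 'a mpoly \<Rightarrow> 'a poly fract) \<Rightarrow> bool" where
  "derivation_along n F \<phi> D \<longleftrightarrow>
     (\<forall>u\<in>local_fractions n \<phi>. \<forall>w\<in>local_fractions n \<phi>. same_germ n F \<phi> u w \<longrightarrow> D u = D w) \<and>
     (\<forall>c. D (Poly_Mapping.single 0 c, 1) = 0) \<and>
     (\<forall>(a, b)\<in>local_fractions n \<phi>. \<forall>(a', b')\<in>local_fractions n \<phi>.
        D (a * b' + a' * b, b * b') = D (a, b) + D (a', b') \<and>
        D (a * a', b * b') =
          Fract (pullback \<phi> a) (pullback \<phi> b) * D (a', b') +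
          Fract (pullback \<phi> a') (pullback \<phi> b') * D (a, b))"

text \<open>
  Sections over \<open>V\<close> of \<open>\<phi>\<^sup>*T\<^sub>X \<otimes> O(m)\<close> for a rational curve \<open>\<phi>\<close> of degree \<open>e\<close> on \<open>X\<close>, where
  \<open>V\<close> is (the set of closed points of) a nonempty open subset of the projective line. As \<open>T\<^sub>X\<close> is
  dual to the locally free sheaf of differentials, the stalk of \<open>\<phi>\<^sup>*T\<^sub>X \<otimes> O(m)\<close> at a closed point
  \<open>v\<close> is the module of derivations from the local ring of \<open>X\<close> at \<open>\<phi>(v)\<close> to the stalk of \<open>O(m)\<close>
  at \<open>v\<close>; a section over \<open>V\<close> is an element of the generic stalk that lies in the stalks
  at all points of \<open>V\<close>.
\<close>
definition tangent_sections ::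
    "nat \<Rightarrow> 'a::field mpoly \<Rightarrow> nat \<Rightarrow> (nat \<Rightarrow> 'a poly) \<Rightarrow> int \<Rightarrow> 'a P1 set \<Rightarrow>
      ('a mpoly \<times> 'a mpoly \<Rightarrow> 'a poly fract) set" where
  "tangent_sections n F e \<phi> m V =
     {D. derivation_along n F \<phi> D \<and>
         (\<forall>v\<in>V. \<forall>(a, b)\<in>local_fractions n \<phi>.
            mpoly_eval id (\<lambda>i. form_at e (\<phi> i) v) b \<noteq> 0 \<longrightarrow> D (a, b) \<in> line_bundle_stalk m v)}"

text \<open>
  Vanishing of the first cohomology group of \<open>\<phi>\<^sup>*T\<^sub>X \<otimes> O(m)\<close>, computed as Cech cohomology for the
  standard affine open cover of the projective line.
\<close>
definition tangent_H1_vanishes ::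
    "nat \<Rightarrow> 'a::field mpoly \<Rightarrow> nat \<Rightarrow> (nat \<Rightarrow> 'a poly) \<Rightarrow> int \<Rightarrow> bool" where
  "tangent_H1_vanishes n F e \<phi> m \<longleftrightarrow>
     (\<forall>D\<in>tangent_sections n F e \<phi> m (UNIV - {Affine 0, Infinity}).
        \<exists>D\<^sub>0\<in>tangent_sections n F e \<phi> m (UNIV - {Infinity}).
        \<exists>D\<^sub>1\<in>tangent_sections n F e \<phi> m (UNIV - {Affine 0}).
          \<forall>u\<in>local_fractions n \<phi>. D u = D\<^sub>0 u - D\<^sub>1 u)"

definition free_rational_curve ::
    "nat \<Rightarrow> 'a::field mpoly \<Rightarrow> nat \<Rightarrow> (nat \<Rightarrow> 'a poly) \<Rightarrow> bool" where
  "free_rational_curve n F e \<phi> \<longleftrightarrow>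
     rational_curve n F e \<phi> \<and> tangent_H1_vanishes n F e \<phi> (-1)"


section \<open>Uniform degree bounds for free rational curves\<close>

definition free_degree_bounds :: "'a::field itself \<Rightarrow> nat \<Rightarrow> int set" where
  "free_degree_bounds _ n =
     {e. \<forall>F :: 'a mpoly. smooth_Fano_hypersurface n F \<longrightarrow>
           (\<exists>e' \<phi>. free_rational_curve n F e' \<phi> \<and> int e' \<le> e)}"

end

(*
Take q = p^a, n = q and the Fermat hypersurface of degree q + 1.  Since the partial derivatives
of its equation are x_i^q, a curve phi of degree e = qb + r is free iff every binary form of degree
(q + 1)e - 1 is a combination of the phi_i^q with coefficients of degree e - 1.  Taking parts with
respect to q-th powers, every polynomial of degree < e + b is then a combination of the phi_i with
coefficients of degree < b.  Counting dimensions, the syzygies of phi of degree < b form a space of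
dimension b - r.

On the other hand write phi_i = sum_{k<q} z^k phi_{i,k}^q.  The equation sum_i phi_i^{q+1} = 0 says
that each (phi_{i,k})_i is a syzygy of phi, and for k > r its degree is < b.  So these span a space
of dimension at most b - r, which forces all phi_i into the span of only (b + 1)^2 polynomials.
This contradicts the surjectivity above unless q + 1 <= (b + 1)^2, so e grows at least like q^{3/2}.
*)
theory Submission
  imports Defs "HOL-Computational_Algebra.Polynomial_Factorial"
begin

text \<open>For n = q the degree q + 1 is the largest Fano degree, and q + 1 = 1 in the field. The
  tangent condition along a curve is therefore linear with coefficients that are exact q-th powers,
  which is what lets Frobenius descent act on it. The obstacle is that freeness is stated with Cech
  cocycles of derivations of local rings: it has to become a lifting property of polynomials with
  degree control at infinity. Only the implication from free to surjective is proved. The bound (b +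
  1)^2 comes from balancing two kinds of residues k. Those with k \<le> r contribute (r + 1)(b + 1)
  monomials. The other q - 1 - r residues are too many to count singly, but their syzygies depend on
  at most b - r basis vectors, each with at most b coefficients per entry. The sum is bounded
  independently of q. Multiplying by the b monomials of degree < b must fill dimension e + b \<ge>
  b(q + 1), and dividing by b > 0 gives the inequality. The argument covers only those n that are
  powers of p, which is enough for a limit superior.\<close>

section \<open>Evaluation of multivariate polynomials\<close>

definition monom_eval :: "(nat \<Rightarrow> 'b::comm_ring_1) \<Rightarrow> (nat \<Rightarrow>\<^sub>0 nat) \<Rightarrow> 'b" where
  "monom_eval x m = (\<Prod>i\<in>Poly_Mapping.keys m. x i ^ Poly_Mapping.lookup m i)"

lemma monom_eval_superset:
  "finite A \<Longrightarrow> Poly_Mapping.keys m \<subseteq> A \<Longrightarrow>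
    monom_eval x m = (\<Prod>i\<in>A. x i ^ Poly_Mapping.lookup m i)"
  unfolding monom_eval_def by (rule prod.mono_neutral_left) (auto simp: in_keys_iff)

lemma monom_eval_add: "monom_eval x (m + m') = monom_eval x m * monom_eval x m'"
proof -
  let ?A = "Poly_Mapping.keys m \<union> Poly_Mapping.keys m'"
  have "monom_eval x (m + m') = (\<Prod>i\<in>?A. x i ^ Poly_Mapping.lookup (m + m') i)"
    by (rule monom_eval_superset) (auto simp: Poly_Mapping.keys_add)
  also have "\<dots> = monom_eval x m * monom_eval x m'"
    by (simp add: monom_eval_superset[of ?A] lookup_add power_add prod.distrib)
  finally show ?thesis .
qed

lemma monom_eval_0 [simp]: "monom_eval x 0 = 1"
  by (simp add: monom_eval_def)

lemma monom_eval_single [simp]: "monom_eval x (Poly_Mapping.single i k) = x i ^ k"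
  by (simp add: monom_eval_def)

lemma poly_mapping_sum_singles:
  "P = (\<Sum>m\<in>Poly_Mapping.keys P. Poly_Mapping.single m (Poly_Mapping.lookup P m))"
proof (rule poly_mapping_eqI)
  fix k
  show "Poly_Mapping.lookup P k = Poly_Mapping.lookup
      (\<Sum>m\<in>Poly_Mapping.keys P. Poly_Mapping.single m (Poly_Mapping.lookup P m)) k"
    by (simp add: lookup_sum lookup_single when_def in_keys_iff)
qed

text \<open>The coefficient map is a parameter of \<open>mpoly_eval\<close>: the identity gives
  values at points, constants give the pullback to the curve, and doubly constant polynomials give
  tangent vectors. All share the multiplicativity proved here.\<close>

locale ring_hom_1 =
  fixes h :: "'a::comm_ring_1 \<Rightarrow> 'b::comm_ring_1"
  assumes hom_add: "h (x + y) = h x + h y"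
    and hom_mult: "h (x * y) = h x * h y"
    and hom_1: "h 1 = 1"
begin

lemma hom_0: "h 0 = 0"
  using hom_add[of 0 0] by simp

lemma hom_sum: "h (sum f A) = (\<Sum>x\<in>A. h (f x))"
  by (induction A rule: infinite_finite_induct) (simp_all add: hom_0 hom_add)

lemma hom_prod: "h (prod f A) = (\<Prod>x\<in>A. h (f x))"
  by (induction A rule: infinite_finite_induct) (simp_all add: hom_1 hom_mult)

lemma hom_power: "h (x ^ n) = h x ^ n"
  by (induction n) (simp_all add: hom_1 hom_mult)

lemma mpoly_eval_superset:
  assumes "finite A" "Poly_Mapping.keys P \<subseteq> A"
  shows "mpoly_eval h x P = (\<Sum>m\<in>A. h (Poly_Mapping.lookup P m) * monom_eval x m)"
  unfolding mpoly_eval_def monom_eval_def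
  by (rule sum.mono_neutral_left) (use assms in \<open>auto simp: in_keys_iff hom_0\<close>)

lemma mpoly_eval_0 [simp]: "mpoly_eval h x 0 = 0"
  by (simp add: mpoly_eval_def)

lemma mpoly_eval_add: "mpoly_eval h x (P + Q) = mpoly_eval h x P + mpoly_eval h x Q"
proof -
  let ?A = "Poly_Mapping.keys P \<union> Poly_Mapping.keys Q"
  have "mpoly_eval h x (P + Q) =
      (\<Sum>m\<in>?A. h (Poly_Mapping.lookup (P + Q) m) * monom_eval x m)"
    by (rule mpoly_eval_superset) (auto simp: Poly_Mapping.keys_add)
  also have "\<dots> = mpoly_eval h x P + mpoly_eval h x Q"
    by (simp add: mpoly_eval_superset[of ?A] lookup_add hom_add distrib_right sum.distrib)
  finally show ?thesis .
qed

lemma mpoly_eval_sum: "mpoly_eval h x (\<Sum>j\<in>A. P j) = (\<Sum>j\<in>A. mpoly_eval h x (P j))"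
  by (induction A rule: infinite_finite_induct) (simp_all add: mpoly_eval_add)

lemma mpoly_eval_single: "mpoly_eval h x (Poly_Mapping.single m c) = h c * monom_eval x m"
  by (subst mpoly_eval_superset[of "{m}"]) auto

lemma mpoly_eval_1 [simp]: "mpoly_eval h x 1 = 1"
  using mpoly_eval_single[of x 0 1] by (simp add: hom_1)

lemma mpoly_eval_mult: "mpoly_eval h x (P * Q) = mpoly_eval h x P * mpoly_eval h x Q"
proof -
  let ?s = "\<lambda>P m. Poly_Mapping.single m (Poly_Mapping.lookup P m)"
  have "P * Q = (\<Sum>m\<in>Poly_Mapping.keys P. ?s P m) * (\<Sum>m\<in>Poly_Mapping.keys Q. ?s Q m)"
    using poly_mapping_sum_singles[of P] poly_mapping_sum_singles[of Q] by simp
  also have "mpoly_eval h x \<dots> =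
      (\<Sum>m\<in>Poly_Mapping.keys P. \<Sum>m'\<in>Poly_Mapping.keys Q.
        mpoly_eval h x (?s P m) * mpoly_eval h x (?s Q m'))"
    by (simp add: sum_product mpoly_eval_sum mult_single mpoly_eval_single monom_eval_add
        hom_mult ac_simps)
  also have "\<dots> = mpoly_eval h x P * mpoly_eval h x Q"
    using poly_mapping_sum_singles[of P] poly_mapping_sum_singles[of Q]
    by (simp add: mpoly_eval_sum[symmetric] flip: sum_product)
  finally show ?thesis .
qed

lemma mpoly_eval_diff: "mpoly_eval h x (P - Q) = mpoly_eval h x P - mpoly_eval h x Q"
  using mpoly_eval_add[of x "P - Q" Q] by (simp add: algebra_simps)

text \<open>Used to pass from the pullback to its value at a point of the curve, and from an
  evaluation over dual numbers to its constant term.\<close>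

lemma hom_mpoly_eval: "h (mpoly_eval g x P) = mpoly_eval (\<lambda>c. h (g c)) (\<lambda>i. h (x i)) P"
  by (simp add: mpoly_eval_def hom_sum hom_mult hom_prod hom_power)

end

interpretation id_hom: ring_hom_1 "id :: 'a::comm_ring_1 \<Rightarrow> 'a"
  by standard auto

interpretation const_hom: ring_hom_1 "\<lambda>c::'a::comm_ring_1. [:c:]"
  by standard auto

text \<open>The outer polynomial variable plays the role of the infinitesimal \<epsilon>; the inner
  one is the coordinate z of the projective line.\<close>

interpretation const2_hom: ring_hom_1 "\<lambda>c::'a::comm_ring_1. [:[:c:]:]"
  by standard (simp_all flip: one_pCons)

interpretation poly_hom: ring_hom_1 "\<lambda>f::'a::comm_ring_1 poly. poly f c" for c
  by standard auto

interpretation coeff0_hom: ring_hom_1 "\<lambda>f::'a::comm_ring_1 poly. coeff f 0"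
  by standard (auto simp: coeff_mult_0)


section \<open>Total degree of monomials and the grading by forms\<close>

definition total_degree :: "(nat \<Rightarrow>\<^sub>0 nat) \<Rightarrow> nat" where
  "total_degree m = (\<Sum>i\<in>Poly_Mapping.keys m. Poly_Mapping.lookup m i)"

lemma total_degree_superset:
  "finite A \<Longrightarrow> Poly_Mapping.keys m \<subseteq> A \<Longrightarrow>
    total_degree m = (\<Sum>i\<in>A. Poly_Mapping.lookup m i)"
  unfolding total_degree_def by (rule sum.mono_neutral_left) (auto simp: in_keys_iff)

lemma total_degree_add: "total_degree (m + m') = total_degree m + total_degree m'"
proof -
  let ?A = "Poly_Mapping.keys m \<union> Poly_Mapping.keys m'"
  have "total_degree (m + m') = (\<Sum>i\<in>?A. Poly_Mapping.lookup (m + m') i)"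
    by (rule total_degree_superset) (auto simp: Poly_Mapping.keys_add)
  also have "\<dots> = total_degree m + total_degree m'"
    by (simp add: total_degree_superset[of ?A] lookup_add sum.distrib)
  finally show ?thesis .
qed

lemma forms_iff:
  "P \<in> forms N d \<longleftrightarrow>
    (\<forall>m\<in>Poly_Mapping.keys P. Poly_Mapping.keys m \<subseteq> {..<N} \<and> total_degree m = d)"
  by (simp add: forms_def total_degree_def)

lemma forms_0 [simp]: "0 \<in> forms N d"
  by (simp add: forms_iff)

lemma forms_1 [simp]: "1 \<in> forms N 0"
  by (simp add: forms_iff total_degree_def)

lemma forms_add: "P \<in> forms N d \<Longrightarrow> Q \<in> forms N d \<Longrightarrow> P + Q \<in> forms N d"
  using Poly_Mapping.keys_add[of P Q] by (fastforce simp: forms_iff)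

lemma forms_sum: "(\<And>j. j \<in> A \<Longrightarrow> P j \<in> forms N d) \<Longrightarrow> (\<Sum>j\<in>A. P j) \<in> forms N d"
  by (induction A rule: infinite_finite_induct) (simp_all add: forms_add)

lemma forms_mult:
  assumes "P \<in> forms N d" "Q \<in> forms N d'"
  shows "P * Q \<in> forms N (d + d')"
  unfolding forms_iff
proof
  fix m assume "m \<in> Poly_Mapping.keys (P * Q)"
  then obtain a b where ab: "m = a + b" "a \<in> Poly_Mapping.keys P" "b \<in> Poly_Mapping.keys Q"
    using Poly_Mapping.keys_mult[of P Q] by auto
  show "Poly_Mapping.keys m \<subseteq> {..<N} \<and> total_degree m = d + d'"
    using assms ab Poly_Mapping.keys_add[of a b] by (fastforce simp: forms_iff total_degree_add)
qed

lemma forms_power: "P \<in> forms N d \<Longrightarrow> P ^ k \<in> forms N (k * d)"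
  by (induction k) (auto intro: forms_mult)


section \<open>Fermat hypersurfaces\<close>

definition mpoly_var :: "nat \<Rightarrow> 'a::comm_ring_1 mpoly" where
  "mpoly_var i = Poly_Mapping.single (Poly_Mapping.single i 1) 1"

lemma mpoly_var_power:
  "mpoly_var i ^ k = Poly_Mapping.single (Poly_Mapping.single i k) (1::'a::comm_ring_1)"
  by (induction k) (simp_all add: mpoly_var_def mult_single flip: single_add)

lemma forms_mpoly_var: "i < N \<Longrightarrow> mpoly_var i \<in> forms N 1"
  by (simp add: forms_iff mpoly_var_def total_degree_def)

lemma (in ring_hom_1) mpoly_eval_var [simp]: "mpoly_eval h x (mpoly_var i) = x i"
  by (simp add: mpoly_var_def mpoly_eval_single hom_1)

lemma (in ring_hom_1) mpoly_eval_power: "mpoly_eval h x (P ^ k) = mpoly_eval h x P ^ k"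
  by (induction k) (simp_all add: mpoly_eval_mult)

definition fermat :: "nat \<Rightarrow> nat \<Rightarrow> 'a::comm_ring_1 mpoly" where
  "fermat N d = (\<Sum>i<N. mpoly_var i ^ d)"

lemma forms_fermat: "fermat N d \<in> forms N d"
  unfolding fermat_def
  using forms_power[OF forms_mpoly_var] by (intro forms_sum) fastforce

lemma (in ring_hom_1) mpoly_eval_fermat: "mpoly_eval h x (fermat N d) = (\<Sum>i<N. x i ^ d)"
  by (simp add: fermat_def mpoly_eval_sum mpoly_eval_power)

lemma lookup_fermat:
  assumes "d > 0"
  shows "Poly_Mapping.lookup (fermat N d) (Poly_Mapping.single i d) =
    (if i < N then 1 else 0 :: 'a::comm_ring_1)"
proof -
  have "Poly_Mapping.single j d = Poly_Mapping.single i d \<longleftrightarrow> j = i" for i j :: nat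
    by (metis assms less_numeral_extra(3) lookup_single_eq lookup_single_not_eq)
  thus ?thesis
    by (simp add: fermat_def mpoly_var_power lookup_sum lookup_single when_def)
qed

lemma keys_fermat:
  assumes "d > 0"
  shows "Poly_Mapping.keys (fermat N d :: 'a::comm_ring_1 mpoly) =
    (\<lambda>i. Poly_Mapping.single i d) ` {..<N}"
proof
  show "Poly_Mapping.keys (fermat N d :: 'a mpoly) \<subseteq> (\<lambda>i. Poly_Mapping.single i d) ` {..<N}"
    unfolding fermat_def mpoly_var_power
    by (rule order_trans[OF Poly_Mapping.keys_sum]) auto
  show "(\<lambda>i. Poly_Mapping.single i d) ` {..<N} \<subseteq> Poly_Mapping.keys (fermat N d :: 'a mpoly)"
    using assms by (auto simp: in_keys_iff lookup_fermat)
qed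

lemma (in ring_hom_1) mpoly_eval_pderiv_fermat:
  assumes "i < N" "d > 0"
  shows "mpoly_eval h x (mpoly_pderiv i (fermat N d)) = of_nat d * x i ^ (d - 1)"
proof -
  have hn: "h (of_nat k) = of_nat k" for k
    by (induction k) (simp_all add: hom_0 hom_1 hom_add)
  have inj: "inj_on (\<lambda>i. Poly_Mapping.single i d) {..<N}"
    by (metis (no_types, lifting) assms(2) inj_onI less_numeral_extra(3) lookup_single_eq
        lookup_single_not_eq)
  have "mpoly_eval h x (mpoly_pderiv i (fermat N d)) =
      (\<Sum>j<N. h (of_nat (Poly_Mapping.lookup (Poly_Mapping.single j d) i)) *
        monom_eval x (Poly_Mapping.single j d - Poly_Mapping.single i 1))"
    unfolding mpoly_pderiv_def keys_fermat[OF assms(2)] sum.reindex[OF inj]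
    by (simp add: mpoly_eval_sum mpoly_eval_single lookup_fermat[OF assms(2)])
  \<comment> \<open>For \<open>j \<noteq> i\<close> the truncated subtraction of exponents does not
    give a derivative, but the coefficient in front is zero.\<close>
  also have "\<dots> = (\<Sum>j<N. if j = i then of_nat d * x i ^ (d - 1) else 0)"
  proof (rule sum.cong)
    fix j assume "j \<in> {..<N}"
    have "Poly_Mapping.single i d - Poly_Mapping.single i 1 = Poly_Mapping.single i (d - 1)"
      by (simp add: single_diff)
    thus "h (of_nat (Poly_Mapping.lookup (Poly_Mapping.single j d) i)) *
        monom_eval x (Poly_Mapping.single j d - Poly_Mapping.single i 1) =
        (if j = i then of_nat d * x i ^ (d - 1) else 0)"
      by (simp add: lookup_single when_def hn hom_0)
  qed simp
  finally show ?thesis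
    using assms by simp
qed

text \<open>Since q + 1 = 1 in the field, the i-th partial derivative is the q-th power of the i-th
  coordinate, and these vanish together only at the origin.\<close>

lemma smooth_Fano_fermat:
  assumes "of_nat q = (0::'a::field)" "q > 0"
  shows "smooth_Fano_hypersurface q (fermat (q + 2) (q + 1) :: 'a mpoly)"
  unfolding smooth_Fano_hypersurface_def smooth_hypersurface_def
proof (intro exI[of _ "q + 1"] conjI notI)
  have "Poly_Mapping.lookup (fermat (q + 2) (q + 1) :: 'a mpoly) (Poly_Mapping.single 0 (q + 1)) = 1"
    by (subst lookup_fermat) auto
  thus "fermat (q + 2) (q + 1) = (0 :: 'a mpoly) \<Longrightarrow> False"
    by auto
  assume "\<exists>x. (\<exists>i<q + 2. x i \<noteq> 0) \<and> mpoly_eval id x (fermat (q + 2) (q + 1) :: 'a mpoly) = 0 \<and>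
    (\<forall>i<q + 2. mpoly_eval id x (mpoly_pderiv i (fermat (q + 2) (q + 1))) = 0)"
  then obtain x :: "nat \<Rightarrow> 'a" and i where i: "i < q + 2" "x i \<noteq> 0"
    and "mpoly_eval id x (mpoly_pderiv i (fermat (q + 2) (q + 1))) = 0"
    by blast
  thus False
    using assms by (subst (asm) id_hom.mpoly_eval_pderiv_fermat) auto
qed (simp_all add: forms_fermat)


section \<open>Linear algebra\<close>

interpretation poly_vs: vector_space "smult :: 'a::field \<Rightarrow> 'a poly \<Rightarrow> 'a poly"
  by standard (auto simp: smult_add_right smult_add_left)

text \<open>A tuple of polynomials is encoded as a polynomial over polynomials, with the index as
  outer exponent, so that tuples form a vector space over the ground field carried by a whole
  type.\<close>

interpretation tuple_vs: vector_space "\<lambda>c::'a::field. smult [:c:] :: 'a poly poly \<Rightarrow> 'a poly poly"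
proof
  fix a b :: 'a and x y :: "'a poly poly"
  have "[:a + b:] = [:a:] + [:b:]"
    by simp
  thus "smult [:a + b:] x = smult [:a:] x + smult [:b:] x"
    by (simp only: smult_add_left)
  show "smult [:1:] x = x"
    by (simp only: smult_1_left flip: one_pCons)
qed (simp_all add: smult_add_right mult.commute)

text \<open>Each \<open>t j\<close> escapes a subspace containing everything before it. In the
  applications \<open>U\<close> is the kernel of a coefficient functional, so a triangular system of
  monomials takes the place of a rank computation.\<close>

lemma (in vector_space) independent_flag:
  assumes "independent S" "finite S"
    and "\<And>j. j < n \<Longrightarrow> \<exists>U. subspace U \<and> S \<union> t ` {..<j} \<subseteq> U \<and> t j \<notin> U"
  shows "independent (S \<union> t ` {..<n}) \<and> card (S \<union> t ` {..<n}) = card S + n"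
  using assms(3)
proof (induction n)
  case 0
  thus ?case
    using assms(1) by simp
next
  case (Suc n)
  obtain U where U: "subspace U" "S \<union> t ` {..<n} \<subseteq> U" "t n \<notin> U"
    using Suc.prems[of n] by blast
  hence "t n \<notin> span (S \<union> t ` {..<n})"
    using span_minimal by blast
  moreover from this have "t n \<notin> S \<union> t ` {..<n}"
    by (meson span_base)
  moreover have "independent (S \<union> t ` {..<n}) \<and> card (S \<union> t ` {..<n}) = card S + n"
    using Suc by simp
  moreover have "S \<union> t ` {..<Suc n} = insert (t n) (S \<union> t ` {..<n})"
    by (auto simp: lessThan_Suc)
  ultimately show ?case
    using assms(2) independent_insertI[of "t n" "S \<union> t ` {..<n}"] by simp
qed

lemma poly_eq_sum_monom:
  assumes "\<And>j. j \<ge> b \<Longrightarrow> coeff f j = 0"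
  shows "f = (\<Sum>j<b. monom (coeff f j) j)"
proof (rule poly_eqI)
  fix n
  show "coeff f n = coeff (\<Sum>j<b. monom (coeff f j) j) n"
    using assms[of n] by (simp add: coeff_sum)
qed

definition tuple :: "nat \<Rightarrow> (nat \<Rightarrow> 'a::field poly) \<Rightarrow> 'a poly poly" where
  "tuple N g = (\<Sum>i<N. monom (g i) i)"

lemma coeff_tuple [simp]: "coeff (tuple N g) i = (if i < N then g i else 0)"
  by (simp add: tuple_def coeff_sum)

definition tuples :: "nat \<Rightarrow> nat \<Rightarrow> 'a::field poly poly set" where
  "tuples N b = {f. (\<forall>i\<ge>N. coeff f i = 0) \<and> (\<forall>i. \<forall>j\<ge>b. coeff (coeff f i) j = 0)}"

lemma tuples_subset_span:
  "tuples N b \<subseteq> tuple_vs.span ((\<lambda>(i, j). monom (monom 1 j) i) ` ({..<N} \<times> {..<b}))"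
    (is "_ \<subseteq> tuple_vs.span ?B")
proof
  fix f :: "'a poly poly" assume f: "f \<in> tuples N b"
  have "f = (\<Sum>i<N. monom (coeff f i) i)"
    using f by (intro poly_eq_sum_monom) (auto simp: tuples_def)
  also have "\<dots> = (\<Sum>i<N. monom (\<Sum>j<b. monom (coeff (coeff f i) j) j) i)"
    by (intro sum.cong arg_cong2[where f = monom] poly_eq_sum_monom)
      (use f in \<open>auto simp: tuples_def\<close>)
  also have "\<dots> = (\<Sum>i<N. \<Sum>j<b. smult [:coeff (coeff f i) j:] (monom (monom 1 j) i))"
    by (simp add: smult_monom monom_sum)
  also have "\<dots> \<in> tuple_vs.span ?B"
    by (intro tuple_vs.span_sum tuple_vs.span_scale tuple_vs.span_base) auto
  finally show "f \<in> tuple_vs.span ?B" .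
qed

lemma card_independent_tuples:
  assumes "tuple_vs.independent S" "S \<subseteq> tuples N b"
  shows "finite S" "card S \<le> N * b"
proof -
  let ?B = "(\<lambda>(i, j). monom (monom (1::'a) j) i) ` ({..<N} \<times> {..<b})"
  have "S \<subseteq> tuple_vs.span ?B"
    using assms(2) tuples_subset_span by blast
  hence "finite S \<and> card S \<le> card ?B"
    using assms(1) by (intro tuple_vs.independent_span_bound) auto
  moreover have "card ?B \<le> card ({..<N} \<times> {..<b})"
    by (rule card_image_le) simp
  ultimately show "finite S" "card S \<le> N * b"
    by auto
qed

text \<open>Rank-nullity for the map \<open>g \<mapsto> \<Sum>i<N. g\<^sub>i \<phi>\<^sub>i\<close> on tuples of polynomials of degree \<open>< b\<close>.\<close>
lemma card_independent_syzygies: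
  fixes \<phi> :: "nat \<Rightarrow> 'a::field poly"
  assumes surj: "\<And>j. j < d \<Longrightarrow> \<exists>g. (\<Sum>i<N. g i * \<phi> i) = monom 1 j \<and> (\<forall>i<N. \<forall>j\<ge>b. coeff (g i) j = 0)"
    and S: "tuple_vs.independent S" "S \<subseteq> tuples N b"
    and syz: "\<And>f. f \<in> S \<Longrightarrow> (\<Sum>i<N. coeff f i * \<phi> i) = 0"
  shows "card S + d \<le> N * b"
proof -
  from surj obtain g where g: "\<And>j. j < d \<Longrightarrow> (\<Sum>i<N. g j i * \<phi> i) = monom 1 j"
    "\<And>j i k. j < d \<Longrightarrow> i < N \<Longrightarrow> k \<ge> b \<Longrightarrow> coeff (g j i) k = 0"
    by metis
  let ?t = "\<lambda>j. tuple N (g j)"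
  have "tuple_vs.independent (S \<union> ?t ` {..<d}) \<and> card (S \<union> ?t ` {..<d}) = card S + d"
  proof (rule tuple_vs.independent_flag)
    fix j assume j: "j < d"
    \<comment> \<open>Elements of \<open>S\<close> map to 0 and the \<open>i\<close>-th lift maps to
      the monomial of degree \<open>i\<close>, so the coefficient of degree \<open>j\<close> first
      becomes nonzero at the \<open>j\<close>-th lift.\<close>
    let ?U = "{f. coeff (\<Sum>i<N. coeff f i * \<phi> i) j = 0}"
    have "tuple_vs.subspace ?U"
      unfolding tuple_vs.subspace_def
    proof (intro conjI allI ballI)
      fix x y :: "'a poly poly" and c :: 'a
      show "0 \<in> ?U"
        by simp
      show "x + y \<in> ?U" if "x \<in> ?U" "y \<in> ?U"
        using that by (simp add: distrib_right sum.distrib)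
      have "(\<Sum>i<N. coeff (smult [:c:] x) i * \<phi> i) = smult c (\<Sum>i<N. coeff x i * \<phi> i)"
        by (simp add: poly_vs.scale_sum_right)
      thus "smult [:c:] x \<in> ?U" if "x \<in> ?U"
        using that by simp
    qed
    moreover have "S \<union> ?t ` {..<j} \<subseteq> ?U"
      using syz g(1) j by auto
    moreover have "?t j \<notin> ?U"
      using g(1)[OF j] by simp
    ultimately show "\<exists>U. tuple_vs.subspace U \<and> S \<union> ?t ` {..<j} \<subseteq> U \<and> ?t j \<notin> U"
      by blast
  qed (use S card_independent_tuples in auto)
  moreover have "S \<union> ?t ` {..<d} \<subseteq> tuples N b"
    using S g(2) by (auto simp: tuples_def)
  ultimately show ?thesis
    using card_independent_tuples by metis
qed

lemma card_ge_if_monoms_in_span: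
  fixes P :: "'a::field poly set"
  assumes "finite P" "\<And>j. j < d \<Longrightarrow> monom 1 j \<in> poly_vs.span P"
  shows "d \<le> card P"
proof -
  have "poly_vs.independent ({} \<union> monom (1::'a) ` {..<d}) \<and>
      card ({} \<union> monom (1::'a) ` {..<d}) = card ({} :: 'a poly set) + d"
  proof (rule poly_vs.independent_flag)
    fix j
    show "\<exists>U. poly_vs.subspace U \<and> {} \<union> monom (1::'a) ` {..<j} \<subseteq> U \<and> monom 1 j \<notin> U"
      by (rule exI[of _ "{f. coeff f j = 0}"]) (auto simp: poly_vs.subspace_def)
  qed (simp_all only: poly_vs.independent_empty finite.emptyI not_False_eq_True)
  moreover from this have "card (monom (1::'a) ` {..<d}) \<le> card P"
    using assms poly_vs.independent_span_bound[of P "monom (1::'a) ` {..<d}"] by auto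
  ultimately show ?thesis
    by simp
qed

section \<open>Powers of Frobenius\<close>

text \<open>The exponent \<open>Suc a\<close> excludes q = 1, so that q vanishes in the field. The
  argument \<open>K\<close> only fixes the type.\<close>

locale frobenius_power =
  fixes q :: nat and K :: "'a::alg_closed_field itself"
  assumes q_power': "\<exists>a. q = CHAR('a) ^ Suc a" and char_pos: "CHAR('a) > 0"
begin

lemma prime_char: "prime CHAR('a)"
  using char_pos by (rule prime_CHAR_semidom)

lemma q_power: obtains a where "q = CHAR('a) ^ Suc a"
  using q_power' by blast

lemma q_pos: "q > 0"
proof -
  obtain a where "q = CHAR('a) ^ Suc a"
    by (rule q_power)
  thus ?thesis
    using char_pos by simp
qed

lemma of_nat_q: "of_nat q = (0 :: 'a)"
proof -
  obtain a where "q = CHAR('a) ^ Suc a"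
    by (rule q_power)
  thus ?thesis
    by simp
qed

lemma frob_poly_sum: "(\<Sum>i\<in>A. f i :: 'a poly) ^ q = (\<Sum>i\<in>A. f i ^ q)"
proof (rule q_power)
  fix a assume "q = CHAR('a) ^ Suc a"
  thus ?thesis
    using prime_char by (intro freshmans_dream_sum'[where n = "Suc a"]) simp_all
qed

lemma frob_inj:
  assumes "x ^ q = (y :: 'a) ^ q"
  shows "x = y"
proof -
  have "(x - y + y) ^ q = (x - y) ^ q + y ^ q"
    by (rule q_power, rule freshmans_dream'[OF prime_char])
  hence "(x - y) ^ q = 0"
    using assms by simp
  thus ?thesis
    by simp
qed

lemma frob_eq_sum:
  assumes "\<And>l. l \<ge> m \<Longrightarrow> coeff f l = (0 :: 'a)"
  shows "f ^ q = (\<Sum>l<m. smult (coeff f l ^ q) (monom 1 (q * l)))"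
proof -
  have "f ^ q = (\<Sum>l<m. monom (coeff f l) l) ^ q"
    using poly_eq_sum_monom[OF assms] by simp
  thus ?thesis
    by (simp add: frob_poly_sum monom_power smult_monom mult.commute)
qed

lemma coeff_frob: "coeff (f ^ q) n = (if q dvd n then coeff f (n div q) ^ q else (0 :: 'a))"
proof -
  let ?m = "Suc (max (degree f) n)"
  have "f ^ q = (\<Sum>l<?m. smult (coeff f l ^ q) (monom 1 (q * l)))"
    by (rule frob_eq_sum) (auto simp: coeff_eq_0)
  hence *: "coeff (f ^ q) n = (\<Sum>l<?m. if q * l = n then coeff f l ^ q else 0)"
    by (auto simp: coeff_sum intro: sum.cong)
  show ?thesis
  proof (cases "q dvd n")
    case True
    then obtain l where l: "n = q * l" ..
    hence "l < ?m"
      using q_pos by (metis le_imp_less_Suc le_max_iff_disj mult.commute mult_le_mono2 nat_mult_1_right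
          Suc_leI One_nat_def)
    thus ?thesis
      using q_pos * l by simp
  next
    case False
    hence "q * l \<noteq> n" for l
      by auto
    thus ?thesis
      using * False by simp
  qed
qed

lemma coeff_monom_frob:
  assumes "k < q" "k' < q"
  shows "coeff (monom 1 k * f ^ q) (k' + q * l) = (if k = k' then coeff f l ^ q else (0 :: 'a))"
proof (cases "k \<le> k' + q * l")
  case True
  have "k = k'" if "q dvd (k' + q * l - k)"
  proof -
    have "(k' + q * l) mod q = k mod q"
      using that mod_eq_dvd_iff_nat[OF True, of q] by blast
    thus ?thesis
      using assms by simp
  qed
  thus ?thesis
    using True q_pos by (auto simp: coeff_monom_mult coeff_frob)
next
  case False
  thus ?thesis
    by (auto simp: coeff_monom_mult)
qed

lemma coeff_sum_monom_frob:
  "k < q \<Longrightarrow> coeff (\<Sum>k<q. monom 1 k * f k ^ q) (k + q * l) = (coeff (f k) l :: 'a) ^ q"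
  by (simp add: coeff_sum coeff_monom_frob)

section \<open>Decomposition of a polynomial by residues of exponents modulo q\<close>

definition qroot :: "'a \<Rightarrow> 'a" where
  "qroot x = (SOME y. y ^ q = x)"

lemma qroot_power [simp]: "qroot x ^ q = x"
  unfolding qroot_def by (rule someI_ex) (rule nth_root_exists[OF q_pos])

lemma qroot_0 [simp]: "qroot 0 = 0"
  using qroot_power[of 0] by (simp del: qroot_power)

text \<open>The polynomials \<open>f\<^sub>k = qpart k f\<close> for \<open>k < q\<close> with \<open>f = \<Sum>k<q. z\<^sup>k f\<^sub>k\<^sup>q\<close>.\<close>
definition qpart :: "nat \<Rightarrow> 'a poly \<Rightarrow> 'a poly" where
  "qpart k f = (\<Sum>l\<le>degree f. monom (qroot (coeff f (k + q * l))) l)"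

lemma coeff_qpart: "coeff (qpart k f) l = qroot (coeff f (k + q * l))"
proof (cases "l \<le> degree f")
  case False
  hence "degree f < k + q * l"
    using q_pos by (metis add_leD2 less_one linorder_not_le mult_le_mono1 nat_mult_1 order_trans)
  thus ?thesis
    using False by (simp add: qpart_def coeff_sum coeff_eq_0)
qed (simp add: qpart_def coeff_sum)

lemma qpart_eqI:
  assumes "f = (\<Sum>k<q. monom 1 k * g k ^ q)" "k < q"
  shows "qpart k f = g k"
proof (rule poly_eqI)
  fix l
  have "coeff (qpart k f) l ^ q = coeff (g k) l ^ q"
    using coeff_sum_monom_frob[OF assms(2), of g l] by (simp add: coeff_qpart assms(1))
  thus "coeff (qpart k f) l = coeff (g k) l"
    by (rule frob_inj)
qed

lemma eq_sum_qpart: "f = (\<Sum>k<q. monom 1 k * qpart k f ^ q)"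
proof (rule poly_eqI)
  fix n
  have "n = n mod q + q * (n div q)" "n mod q < q"
    using q_pos by auto
  thus "coeff f n = coeff (\<Sum>k<q. monom 1 k * qpart k f ^ q) n"
    using coeff_sum_monom_frob[of "n mod q" "\<lambda>k. qpart k f" "n div q"]
    by (metis coeff_qpart qroot_power)
qed

lemma qpart_monom_frob:
  assumes "k < q"
  shows "qpart k (monom 1 k * f ^ q) = f"
proof -
  have "(\<Sum>k'<q. monom 1 k' * (if k' = k then f else 0) ^ q) =
      (\<Sum>k'<q. if k' = k then monom 1 k' * f ^ q else 0)"
    using q_pos by (intro sum.cong) auto
  thus ?thesis
    using assms qpart_eqI[of "monom 1 k * f ^ q" "\<lambda>k'. if k' = k then f else 0" k] by simp
qed

text \<open>q-th powers act as scalars on the decomposition by residues and leave it as their q-th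
  roots. Thus one relation among the \<open>\<phi> i ^ q\<close> yields q relations among the
  \<open>\<phi> i\<close>.\<close>

lemma qpart_sum:
  assumes "k < q"
  shows "qpart k (\<Sum>i\<in>A. g i * \<phi> i ^ q) = (\<Sum>i\<in>A. qpart k (g i) * \<phi> i)"
proof (rule qpart_eqI[OF _ assms])
  have "(\<Sum>i\<in>A. g i * \<phi> i ^ q) = (\<Sum>i\<in>A. (\<Sum>k<q. monom 1 k * qpart k (g i) ^ q) * \<phi> i ^ q)"
    by (intro sum.cong arg_cong2[where f = "(*)"] eq_sum_qpart refl)
  also have "\<dots> = (\<Sum>k<q. monom 1 k * (\<Sum>i\<in>A. qpart k (g i) * \<phi> i) ^ q)"
    unfolding frob_poly_sum sum_distrib_left sum_distrib_right
    by (subst sum.swap) (simp add: power_mult_distrib mult.assoc)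
  finally show "(\<Sum>i\<in>A. g i * \<phi> i ^ q) = (\<Sum>k<q. monom 1 k * (\<Sum>i\<in>A. qpart k (g i) * \<phi> i) ^ q)" .
qed

text \<open>Lift \<open>monom 1 (q - 1) * f ^ q\<close> and take the part of residue q - 1. The
  largest residue is the one that pushes the coefficients below degree \<open>e div q\<close>; the
  lifted polynomial has degree at most q - 1 + q(e + b - 1) < (q + 1)e for b =
  \<open>e div q\<close>, because qb \<le> e.\<close>

lemma frobenius_descent:
  fixes \<phi> :: "nat \<Rightarrow> 'a poly"
  assumes surj: "\<And>h. (\<forall>j\<ge>(q + 1) * e. coeff h j = 0) \<Longrightarrow>
      \<exists>g. h = (\<Sum>i<N. g i * \<phi> i ^ q) \<and> (\<forall>i<N. \<forall>j\<ge>e. coeff (g i) j = 0)"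
    and "\<forall>j\<ge>e + e div q. coeff f j = 0"
  shows "\<exists>g. (\<Sum>i<N. g i * \<phi> i) = f \<and> (\<forall>i<N. \<forall>j\<ge>e div q. coeff (g i) j = 0)"
proof -
  let ?h = "monom 1 (q - 1) * f ^ q"
  have "coeff ?h j = 0" if j: "j \<ge> (q + 1) * e" for j
  proof (cases "j \<ge> q - 1 \<and> q dvd (j - (q - 1))")
    case True
    then obtain l where l: "j - (q - 1) = q * l"
      by blast
    have "l \<ge> e + e div q"
    proof (rule ccontr)
      assume "\<not> ?thesis"
      hence "q * Suc l \<le> q * (e + e div q)"
        by (intro mult_le_mono2) simp
      also have "\<dots> \<le> q * e + e"
        by (simp add: distrib_left)
      finally show False
        using l j True q_pos by (simp add: algebra_simps)
    qed
    thus ?thesis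
      using assms(2) l q_pos by (simp add: coeff_monom_mult coeff_frob)
  qed (auto simp: coeff_monom_mult coeff_frob)
  then obtain g where g: "?h = (\<Sum>i<N. g i * \<phi> i ^ q)" "\<And>i j. i < N \<Longrightarrow> j \<ge> e \<Longrightarrow> coeff (g i) j = 0"
    using surj[of ?h] by blast
  have "f = (\<Sum>i<N. qpart (q - 1) (g i) * \<phi> i)"
    using qpart_monom_frob[of "q - 1" f] qpart_sum[of "q - 1" g \<phi> "{..<N}"] g(1) q_pos by simp
  moreover have "coeff (qpart (q - 1) (g i)) j = 0" if "i < N" "j \<ge> e div q" for i j
  proof -
    have "e < q * Suc (e div q)"
      using q_pos by (metis dividend_less_times_div mult_Suc_right)
    also have "\<dots> \<le> q * Suc j"
      using that by (intro mult_le_mono2) simp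
    finally have "e \<le> q - 1 + q * j"
      using q_pos by simp
    thus ?thesis
      using g(2)[OF that(1)] by (simp add: coeff_qpart)
  qed
  ultimately show ?thesis
    by (intro exI[of _ "\<lambda>i. qpart (q - 1) (g i)"]) auto
qed

text \<open>
  The hypothesis on \<open>\<phi>\<close> leaves only a space of dimension \<open>b - r\<close> of syzygies of degree \<open>< b\<close>, where
  \<open>e = qb + r\<close>.  The equation makes every \<open>(qpart k (\<phi> i))\<^sub>i\<close> a syzygy, of degree \<open>< b\<close> if \<open>k > r\<close>.
\<close>
lemma degree_bound_from_syzygies:
  fixes \<phi> :: "nat \<Rightarrow> 'a poly"
  assumes deg: "\<And>i. i < q + 2 \<Longrightarrow> degree (\<phi> i) \<le> e"
    and eqn: "(\<Sum>i<q + 2. \<phi> i ^ (q + 1)) = 0"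
    and b: "b = e div q"
    and surj: "\<And>f. (\<forall>j\<ge>e + b. coeff f j = 0) \<Longrightarrow>
      \<exists>g. (\<Sum>i<q + 2. g i * \<phi> i) = f \<and> (\<forall>i<q + 2. \<forall>j\<ge>b. coeff (g i) j = 0)"
  shows "e + b \<le> b * ((b + 1) * (b + 1))"
proof -
  let ?N = "q + 2"
  define r where "r = e mod q"
  have e: "e = q * b + r" and "r < q"
    using q_pos by (auto simp: b r_def)
  have monom_surj: "\<exists>g. (\<Sum>i<?N. g i * \<phi> i) = monom 1 j \<and> (\<forall>i<?N. \<forall>j\<ge>b. coeff (g i) j = 0)"
    if "j < e + b" for j
    using that by (intro surj) auto
  define T where "T k = tuple ?N (\<lambda>i. qpart k (\<phi> i))" for k
  have syz: "(\<Sum>i<?N. qpart k (\<phi> i) * \<phi> i) = 0" if "k < q" for k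
  proof -
    have "(\<Sum>i<?N. qpart k (\<phi> i) * \<phi> i) = qpart k (\<Sum>i<?N. \<phi> i * \<phi> i ^ q)"
      using qpart_sum[OF that] by metis
    also have "(\<Sum>i<?N. \<phi> i * \<phi> i ^ q) = 0"
      using eqn by simp
    finally show ?thesis
      by (simp add: qpart_def)
  qed
  have small: "coeff (qpart k (\<phi> i)) j = 0" if "i < ?N" "j \<ge> b" "k > r" for i j k
  proof -
    have "q * b \<le> q * j"
      using that by simp
    hence "degree (\<phi> i) < k + q * j"
      using that deg[OF that(1)] e by linarith
    thus ?thesis
      by (simp add: coeff_qpart coeff_eq_0)
  qed
  have small': "coeff (qpart k (\<phi> i)) j = 0" if "i < ?N" "j \<ge> b + 1" for i j k
  proof -
    have "q * (b + 1) \<le> q * j"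
      using that by (intro mult_le_mono2) simp
    hence "degree (\<phi> i) < k + q * j"
      using deg[OF that(1)] e \<open>r < q\<close> by simp
    thus ?thesis
      by (simp add: coeff_qpart coeff_eq_0)
  qed
  obtain B where B: "B \<subseteq> T ` {r<..<q}" "tuple_vs.independent B" "T ` {r<..<q} \<subseteq> tuple_vs.span B"
    using tuple_vs.maximal_independent_subset by blast
  have finB: "finite B"
    using B(1) finite_subset by blast
  have B_tuples: "B \<subseteq> tuples ?N b"
    using B(1) small by (auto simp: T_def tuples_def)
  have "(\<Sum>i<?N. coeff f i * \<phi> i) = 0" if "f \<in> B" for f
    using B(1) that syz by (auto simp: T_def)
  hence "card B + (e + b) \<le> ?N * b"
    using card_independent_syzygies[OF monom_surj B(2) B_tuples] by blast
  hence cardB: "card B + r \<le> b"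
    by (simp add: e algebra_simps)
  have "\<forall>k\<in>{r<..<q}. \<exists>c. T k = (\<Sum>v\<in>B. smult [:c v:] v)"
    using B(3) unfolding tuple_vs.span_finite[OF finB] by blast
  from bchoice[OF this] obtain c
    where c: "\<And>k. k \<in> {r<..<q} \<Longrightarrow> T k = (\<Sum>v\<in>B. smult [:c k v:] v)"
    by blast
  \<comment> \<open>Substituting \<open>T k\<close> as a combination of \<open>B\<close> into the
    parts with \<open>k > r\<close> and collecting the q-th power of each \<open>coeff v i\<close>
    leaves this factor. It does not depend on \<open>i\<close>, so one set \<open>P\<close> serves
    all \<open>\<phi> i\<close>.\<close>
  define Q where "Q v = (\<Sum>k\<in>{r<..<q}. smult (c k v ^ q) (monom 1 k))" for v
  define P1 where "P1 = (\<lambda>(k, l). monom (1::'a) (k + q * l)) ` ({..r} \<times> {..<b + 1})"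
  define P2 where "P2 = (\<lambda>(v, l). Q v * monom 1 (q * l)) ` (B \<times> {..<b})"
  define P where "P = P1 \<union> P2"
  \<comment> \<open>The shifts by \<open>s < b\<close> account for multiplication by coefficients of
    degree < b.\<close>
  define P' where "P' = (\<lambda>(s, x). monom 1 s * x) ` ({..<b} \<times> P)"
  have fin: "finite P1" "finite P2" "finite P" "finite P'"
    using finB by (auto simp: P1_def P2_def P_def P'_def)
  have "card P1 \<le> card ({..r} \<times> {..<b + 1})" "card P2 \<le> card (B \<times> {..<b})"
    unfolding P1_def P2_def using finB by (intro card_image_le; simp)+
  \<comment> \<open>The bound \<open>card B + r \<le> b\<close> absorbs the monomials with residue
    at most \<open>r\<close> and the contribution of \<open>B\<close> into a single factor b +
    1.\<close>
  hence "card P \<le> (r + 1) * (b + 1) + card B * b"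
    unfolding P_def using card_Un_le[of P1 P2] by (simp add: card_cartesian_product)
  also have "\<dots> \<le> (r + 1) * (b + 1) + card B * (b + 1)"
    by simp
  also have "\<dots> = (card B + r + 1) * (b + 1)"
    by (simp add: algebra_simps)
  also have "\<dots> \<le> (b + 1) * (b + 1)"
    using cardB by (intro mult_le_mono1) simp
  finally have cardP: "card P \<le> (b + 1) * (b + 1)" .
  have \<phi>_span: "\<phi> i \<in> poly_vs.span P" if i: "i < ?N" for i
  proof -
    have "\<phi> i = (\<Sum>k<q. monom 1 k * qpart k (\<phi> i) ^ q)"
      by (rule eq_sum_qpart)
    also have "{..<q} = {..r} \<union> {r<..<q}"
      using \<open>r < q\<close> by auto
    also have "(\<Sum>k\<in>\<dots>. monom 1 k * qpart k (\<phi> i) ^ q) =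
        (\<Sum>k\<le>r. monom 1 k * qpart k (\<phi> i) ^ q) + (\<Sum>k\<in>{r<..<q}. monom 1 k * qpart k (\<phi> i) ^ q)"
      by (rule sum.union_disjoint) auto
    also have "(\<Sum>k\<le>r. monom 1 k * qpart k (\<phi> i) ^ q) =
        (\<Sum>k\<le>r. \<Sum>l<b + 1. smult (coeff (qpart k (\<phi> i)) l ^ q) (monom 1 (k + q * l)))"
      using small'[OF i]
      by (subst frob_eq_sum[where m = "b + 1"]) (auto simp: distrib_left sum_distrib_left mult_monom)
    also have "(\<Sum>k\<in>{r<..<q}. monom 1 k * qpart k (\<phi> i) ^ q) = (\<Sum>v\<in>B. Q v * coeff v i ^ q)"
    proof -
      have "qpart k (\<phi> i) = (\<Sum>v\<in>B. smult (c k v) (coeff v i))" if "k \<in> {r<..<q}" for k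
      proof -
        have "qpart k (\<phi> i) = coeff (T k) i"
          using i by (simp add: T_def)
        thus ?thesis
          using c that by (simp add: coeff_sum)
      qed
      hence "(\<Sum>k\<in>{r<..<q}. monom 1 k * qpart k (\<phi> i) ^ q) =
          (\<Sum>k\<in>{r<..<q}. \<Sum>v\<in>B. smult (c k v ^ q) (monom 1 k) * coeff v i ^ q)"
        by (intro sum.cong) (simp_all add: frob_poly_sum smult_power sum_distrib_left)
      also have "\<dots> = (\<Sum>v\<in>B. Q v * coeff v i ^ q)"
        unfolding Q_def sum_distrib_right by (rule sum.swap)
      finally show ?thesis .
    qed
    also have "\<dots> = (\<Sum>v\<in>B. \<Sum>l<b. smult (coeff (coeff v i) l ^ q) (Q v * monom 1 (q * l)))"
    proof (rule sum.cong)
      fix v assume "v \<in> B"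
      hence "coeff v i ^ q = (\<Sum>l<b. smult (coeff (coeff v i) l ^ q) (monom 1 (q * l)))"
        using B_tuples by (intro frob_eq_sum) (auto simp: tuples_def)
      thus "Q v * coeff v i ^ q = (\<Sum>l<b. smult (coeff (coeff v i) l ^ q) (Q v * monom 1 (q * l)))"
        by (simp add: sum_distrib_left)
    qed simp
    finally have "\<phi> i = (\<Sum>k\<le>r. \<Sum>l<b + 1. smult (coeff (qpart k (\<phi> i)) l ^ q) (monom 1 (k + q * l))) +
        (\<Sum>v\<in>B. \<Sum>l<b. smult (coeff (coeff v i) l ^ q) (Q v * monom 1 (q * l)))" .
    also have "\<dots> \<in> poly_vs.span P"
      by (intro poly_vs.span_add poly_vs.span_sum poly_vs.span_scale poly_vs.span_base)
        (auto simp: P_def P1_def P2_def)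
    finally show ?thesis .
  qed
  have P'_span: "monom 1 s * x \<in> poly_vs.span P'" if "s < b" "x \<in> poly_vs.span P" for s x
    using that(2)
  proof (rule poly_vs.span_induct)
    show "poly_vs.subspace {x. monom 1 s * x \<in> poly_vs.span P'}"
      by (auto simp: poly_vs.subspace_def distrib_left
          intro: poly_vs.span_zero poly_vs.span_add poly_vs.span_scale)
    show "monom 1 s * x \<in> poly_vs.span P'" if "x \<in> P" for x
      using that \<open>s < b\<close> by (intro poly_vs.span_base) (auto simp: P'_def)
  qed
  have "monom 1 j \<in> poly_vs.span P'" if j: "j < e + b" for j
  proof -
    obtain g where g: "(\<Sum>i<?N. g i * \<phi> i) = monom 1 j" "\<And>i j. i < ?N \<Longrightarrow> j \<ge> b \<Longrightarrow> coeff (g i) j = 0"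
      using monom_surj[OF j] by blast
    have "g i * \<phi> i = (\<Sum>s<b. smult (coeff (g i) s) (monom 1 s * \<phi> i))" if "i < ?N" for i
    proof -
      have "g i = (\<Sum>s<b. monom (coeff (g i) s) s)"
        by (rule poly_eq_sum_monom) (rule g(2)[OF that])
      hence "g i * \<phi> i = (\<Sum>s<b. monom (coeff (g i) s) s) * \<phi> i"
        by simp
      also have "\<dots> = (\<Sum>s<b. smult (coeff (g i) s) (monom 1 s) * \<phi> i)"
        unfolding smult_monom by (simp add: sum_distrib_right)
      finally show ?thesis
        by simp
    qed
    hence "monom 1 j = (\<Sum>i<?N. \<Sum>s<b. smult (coeff (g i) s) (monom 1 s * \<phi> i))"
      using g(1) by simp
    also have "\<dots> \<in> poly_vs.span P'"
      using \<phi>_span P'_span by (intro poly_vs.span_sum poly_vs.span_scale) auto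
    finally show ?thesis .
  qed
  hence "e + b \<le> card P'"
    using card_ge_if_monoms_in_span fin(4) by blast
  also have "\<dots> \<le> card ({..<b} \<times> P)"
    unfolding P'_def using fin(3) by (intro card_image_le) auto
  also have "\<dots> \<le> b * ((b + 1) * (b + 1))"
    using mult_le_mono2[OF cardP, of b] by (simp add: card_cartesian_product)
  finally show ?thesis .
qed

text \<open>If \<open>e div q\<close> were 0, the estimate from syzygies would read e \<le> 0.
  Otherwise \<open>e div q\<close> can be cancelled, since q times it is at most e.\<close>

lemma frobenius_degree_bound:
  fixes \<phi> :: "nat \<Rightarrow> 'a poly"
  assumes deg: "\<And>i. i < q + 2 \<Longrightarrow> degree (\<phi> i) \<le> e"
    and eqn: "(\<Sum>i<q + 2. \<phi> i ^ (q + 1)) = 0"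
    and surj: "\<And>h. (\<forall>j\<ge>(q + 1) * e. coeff h j = 0) \<Longrightarrow>
      \<exists>g. h = (\<Sum>i<q + 2. g i * \<phi> i ^ q) \<and> (\<forall>i<q + 2. \<forall>j\<ge>e. coeff (g i) j = 0)"
    and "e > 0"
  shows "q + 1 \<le> (e div q + 1) * (e div q + 1)"
proof -
  let ?b = "e div q"
  have *: "e + ?b \<le> ?b * ((?b + 1) * (?b + 1))"
    using deg eqn refl frobenius_descent[OF surj] by (rule degree_bound_from_syzygies)
  hence "?b > 0"
    using \<open>e > 0\<close> by (intro Nat.gr0I) auto
  have "?b * (q + 1) \<le> e + ?b"
    by simp
  also note *
  finally show ?thesis
    using \<open>?b > 0\<close> by (subst (asm) mult_le_cancel1) simp
qed

end


section \<open>Bounds on degrees and Bezout\<close>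

text \<open>Avoids the junk value \<open>degree 0 = 0\<close>.\<close>
definition degree_less :: "'a::zero poly \<Rightarrow> nat \<Rightarrow> bool" where
  "degree_less f n \<longleftrightarrow> (\<forall>j\<ge>n. coeff f j = 0)"

lemma degree_less_iff: "degree_less f n \<longleftrightarrow> f = 0 \<or> degree f < n"
proof
  assume f: "degree_less f n"
  show "f = 0 \<or> degree f < n"
  proof (rule ccontr)
    assume "\<not> ?thesis"
    thus False
      using f unfolding degree_less_def by (metis leading_coeff_0_iff not_less)
  qed
qed (auto simp: degree_less_def coeff_eq_0)

lemma degree_less_add: "degree_less f n \<Longrightarrow> degree_less g n \<Longrightarrow> degree_less (f + g) n"
  by (simp add: degree_less_def)

lemma degree_less_diff: "degree_less f n \<Longrightarrow> degree_less g n \<Longrightarrow> degree_less (f - g :: 'a::ab_group_add poly) n"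
  by (simp add: degree_less_def)

lemma degree_less_sum: "(\<And>i. i \<in> A \<Longrightarrow> degree_less (f i) n) \<Longrightarrow> degree_less (\<Sum>i\<in>A. f i) n"
  by (simp add: degree_less_def coeff_sum)

lemma degree_less_mono: "degree_less f n \<Longrightarrow> n \<le> m \<Longrightarrow> degree_less f m"
  by (simp add: degree_less_def)

lemma degree_less_mult:
  fixes f g :: "'a::idom poly"
  assumes "degree_less f n" "degree g \<le> m"
  shows "degree_less (f * g) (n + m)"
  using assms by (cases "f = 0 \<or> g = 0") (auto simp: degree_less_iff degree_mult_eq)

lemma degree_less_mult_cancel:
  fixes f g :: "'a::idom poly"
  assumes "degree_less (f * g) (n + m)" "degree g = m" "g \<noteq> 0"
  shows "degree_less f n"
  using assms by (cases "f = 0 \<or> g = 0") (auto simp: degree_less_iff degree_mult_eq)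

text \<open>A nonzero element of least degree generates the ideal of the \<open>\<phi> i\<close>; if
  it were not constant, its root would be a common zero.\<close>

lemma bezout_no_common_zero:
  fixes \<phi> :: "nat \<Rightarrow> 'a::alg_closed_field poly"
  assumes "\<And>c. \<exists>i<N. poly (\<phi> i) c \<noteq> 0"
  shows "\<exists>u. (\<Sum>i<N. u i * \<phi> i) = 1"
proof -
  let ?I = "{f. \<exists>u. f = (\<Sum>i<N. u i * \<phi> i)}"
  have I_lin: "f - g * h \<in> ?I" if "f \<in> ?I" "h \<in> ?I" for f g h
  proof -
    obtain u v where "f = (\<Sum>i<N. u i * \<phi> i)" "h = (\<Sum>i<N. v i * \<phi> i)"
      using \<open>f \<in> ?I\<close> \<open>h \<in> ?I\<close> by blast
    hence "f - g * h = (\<Sum>i<N. (u i - g * v i) * \<phi> i)"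
      by (simp add: left_diff_distrib sum_subtractf sum_distrib_left mult.assoc)
    thus ?thesis
      by (intro CollectI exI)
  qed
  have I_\<phi>: "\<phi> i \<in> ?I" if "i < N" for i
  proof -
    have "\<phi> i = (\<Sum>j<N. (if j = i then 1 else 0) * \<phi> j)"
      using that by (simp add: if_distrib[of "\<lambda>x. x * _"] cong: if_cong)
    thus ?thesis
      by (intro CollectI exI)
  qed
  obtain i where "i < N" "poly (\<phi> i) 0 \<noteq> 0"
    using assms by blast
  hence "\<phi> i \<in> ?I \<and> \<phi> i \<noteq> 0"
    using I_\<phi> by auto
  then obtain d where d: "d \<in> ?I \<and> d \<noteq> 0"
    and d_min: "\<And>f. f \<in> ?I \<and> f \<noteq> 0 \<Longrightarrow> degree d \<le> degree f"
    using ex_has_least_nat[of "\<lambda>f. f \<in> ?I \<and> f \<noteq> 0" "\<phi> i" degree] by blast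
  have dvd: "d dvd \<phi> i" if "i < N" for i
  proof (rule ccontr)
    assume "\<not> ?thesis"
    hence "\<phi> i mod d \<noteq> 0" "degree (\<phi> i mod d) < degree d"
      using d degree_mod_less[of d "\<phi> i"] by (auto simp: mod_eq_0_iff_dvd)
    moreover have "\<phi> i mod d \<in> ?I"
      unfolding minus_div_mult_eq_mod[symmetric]
      by (rule I_lin[OF I_\<phi>[OF that] conjunct1[OF d]])
    ultimately show False
      using d_min[OF conjI, of "\<phi> i mod d"] by linarith
  qed
  have "degree d = 0"
  proof (rule ccontr)
    assume "\<not> ?thesis"
    then obtain c where "poly d c = 0"
      using alg_closed_imp_poly_has_root by blast
    thus False
      using assms[of c] dvd by (meson poly_eq_0_iff_dvd dvd_trans)
  qed
  then obtain a where a: "d = [:a:]" "a \<noteq> 0"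
    using d degree_eq_zeroE by (metis pCons_0_0)
  obtain u where u: "d = (\<Sum>i<N. u i * \<phi> i)"
    using d by blast
  have "(\<Sum>i<N. smult (inverse a) (u i) * \<phi> i) = smult (inverse a) (\<Sum>i<N. u i * \<phi> i)"
    by (simp add: poly_vs.scale_sum_right)
  also have "\<dots> = smult (inverse a) d"
    by (simp only: u)
  also have "\<dots> = 1"
    using a by (simp add: one_pCons)
  finally show ?thesis
    by (intro exI[of _ "\<lambda>i. smult (inverse a) (u i)"])
qed

text \<open>
  \<open>g\<^sub>i / z\<^sup>M\<close> are sections, over the complement of \<open>0\<close>, of the line bundle of functions with a
  pole of order \<open>< e\<close> at infinity.
\<close>
lemma bezout_at_infinity:
  fixes \<psi> :: "nat \<Rightarrow> 'a::field poly"
  assumes deg: "\<And>i. i < N \<Longrightarrow> degree (\<psi> i) \<le> m"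
    and l: "l < N" "degree (\<psi> l) = m" "\<psi> l \<noteq> 0"
    and v: "(\<Sum>i<N. v i * \<psi> i) = 1"
    and h: "degree_less h (m + e)"
  shows "\<exists>M g. (\<Sum>i<N. g i * \<psi> i) = monom 1 M * h \<and> (\<forall>i<N. degree_less (g i) (M + e))"
proof -
  \<comment> \<open>Large enough for the remainders, of degree < m, and for their products with
    \<open>\<psi> i\<close>, of degree < 2m.\<close>
  define M where "M = 2 * m"
  let ?h = "monom 1 M * h"
  let ?A = "{..<N} - {l}"
  define r where "r i = (?h * v i) mod \<psi> l" for i
  define s where "s i = (?h * v i) div \<psi> l" for i
  \<comment> \<open>Every component except \<open>l\<close> is reduced modulo
    \<open>\<psi> l\<close>, and the quotients move to component \<open>l\<close> by the Koszul
    relations between \<open>\<psi> i\<close> and \<open>\<psi> l\<close>. The equation then bounds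
    \<open>g l\<close>, as \<open>\<psi> l\<close> has exact degree m, that is, does not vanish at
    infinity.\<close>
  define g where "g i = (if i = l then ?h * v l + (\<Sum>i\<in>?A. s i * \<psi> i) else r i)" for i
  have rs: "?h * v i = s i * \<psi> l + r i" for i
    by (simp add: r_def s_def)
  have split: "(\<Sum>i<N. f i) = f l + (\<Sum>i\<in>?A. f i)" for f :: "nat \<Rightarrow> 'a poly"
    using l(1) by (simp add: sum.remove)
  have eq: "(\<Sum>i<N. g i * \<psi> i) = ?h"
  proof -
    have "(\<Sum>i<N. g i * \<psi> i) = g l * \<psi> l + (\<Sum>i\<in>?A. r i * \<psi> i)"
      unfolding split by (simp add: g_def)
    also have "\<dots> = ?h * v l * \<psi> l + (\<Sum>i\<in>?A. s i * \<psi> l * \<psi> i + r i * \<psi> i)"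
      by (simp add: g_def distrib_left sum.distrib sum_distrib_left mult.commute mult.left_commute)
    also have "\<dots> = ?h * v l * \<psi> l + (\<Sum>i\<in>?A. ?h * v i * \<psi> i)"
      by (simp add: rs distrib_right)
    also have "\<dots> = ?h * (\<Sum>i<N. v i * \<psi> i)"
      unfolding split by (simp add: distrib_left sum_distrib_left mult.assoc)
    finally show ?thesis
      by (simp add: v)
  qed
  have r: "degree_less (r i) m" for i
    using degree_mod_less[OF l(3), of "?h * v i"] l(2) by (auto simp: degree_less_iff r_def)
  have "degree_less (g l) (M + e)"
  proof (rule degree_less_mult_cancel[OF _ l(2,3)])
    have "g l * \<psi> l = ?h - (\<Sum>i\<in>?A. r i * \<psi> i)"
      using eq unfolding split by (simp add: g_def algebra_simps)
    also have "degree_less \<dots> (M + e + m)"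
    proof (rule degree_less_diff)
      show "degree_less ?h (M + e + m)"
        using degree_less_mult[OF h degree_monom_le[of 1 M]] by (simp add: ac_simps)
      have "degree_less (r i * \<psi> i) (M + e + m)" if "i < N" for i
        by (rule degree_less_mono[OF degree_less_mult[OF r deg[OF that]]]) (simp add: M_def)
      thus "degree_less (\<Sum>i\<in>?A. r i * \<psi> i) (M + e + m)"
        by (intro degree_less_sum) simp
    qed
    finally show "degree_less (g l * \<psi> l) (M + e + m)" .
  qed
  moreover have "degree_less (g i) (M + e)" if "i \<noteq> l" for i
    using that degree_less_mono[OF r, of "M + e" i] by (simp add: g_def M_def)
  ultimately show ?thesis
    using eq by metis
qed


section \<open>Local rings of the projective line\<close>

interpretation to_fract_hom: ring_hom_1 to_fract
  by standard simp_all

lemma stalk_AffineI: "poly g c \<noteq> 0 \<Longrightarrow> Fract f g \<in> line_bundle_stalk m (Affine c)"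
  by (auto simp: line_bundle_stalk_def)

lemma stalk_AffineE:
  assumes "x \<in> line_bundle_stalk m (Affine c)"
  obtains f g where "x = Fract f g" "poly g c \<noteq> 0" "g \<noteq> 0"
  using assms that by (fastforce simp: line_bundle_stalk_def)

lemma stalk_Affine_to_fract: "to_fract f \<in> line_bundle_stalk m (Affine c)"
  unfolding to_fract_def by (rule stalk_AffineI) simp

lemma stalk_Affine_mult:
  assumes "x \<in> line_bundle_stalk m (Affine c)" "y \<in> line_bundle_stalk m (Affine c)"
  shows "x * y \<in> line_bundle_stalk m (Affine c)"
  using assms by (auto elim!: stalk_AffineE intro!: stalk_AffineI)

lemma stalk_Affine_add:
  assumes "x \<in> line_bundle_stalk m (Affine c)" "y \<in> line_bundle_stalk m (Affine c)"
  shows "x + y \<in> line_bundle_stalk m (Affine c)"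
  using assms by (auto elim!: stalk_AffineE intro!: stalk_AffineI)

lemma stalk_Affine_diff:
  assumes "x \<in> line_bundle_stalk m (Affine c)" "y \<in> line_bundle_stalk m (Affine c)"
  shows "x - y \<in> line_bundle_stalk m (Affine c)"
  using assms by (auto elim!: stalk_AffineE intro!: stalk_AffineI)

lemma stalk_Affine_sum:
  "(\<And>i. i \<in> A \<Longrightarrow> x i \<in> line_bundle_stalk m (Affine c)) \<Longrightarrow>
    (\<Sum>i\<in>A. x i) \<in> line_bundle_stalk m (Affine c)"
  using stalk_Affine_to_fract[of 0 m c]
  by (induction A rule: infinite_finite_induct) (simp_all add: stalk_Affine_add)

text \<open>In a fraction with denominator of least degree, a root of the denominator is also a root
  of the numerator by regularity there, and the linear factor cancels.\<close>

lemma regular_on_affine_line: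
  fixes x :: "'a::alg_closed_field poly fract"
  assumes "\<And>c. x \<in> line_bundle_stalk m (Affine c)"
  shows "\<exists>f. x = to_fract f"
proof -
  obtain f0 g0 where "x = Fract f0 g0 \<and> g0 \<noteq> 0"
    using assms by (metis stalk_AffineE)
  hence "\<exists>g. \<exists>f. x = Fract f g \<and> g \<noteq> 0"
    by blast
  from this ex_has_least_nat[of "\<lambda>g. \<exists>f. x = Fract f g \<and> g \<noteq> 0" _ degree]
  obtain g where "\<exists>f. x = Fract f g \<and> g \<noteq> 0"
    and g_min: "\<And>g'. \<exists>f. x = Fract f g' \<and> g' \<noteq> 0 \<Longrightarrow> degree g \<le> degree g'"
    by blast
  then obtain f where f: "x = Fract f g" "g \<noteq> 0"
    by blast
  have "degree g = 0"
  proof (rule ccontr)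
    assume "degree g \<noteq> 0"
    then obtain c where c: "poly g c = 0"
      using alg_closed_imp_poly_has_root by blast
    obtain f1 g1 where f1: "x = Fract f1 g1" "poly g1 c \<noteq> 0" "g1 \<noteq> 0"
      using assms by (rule stalk_AffineE)
    have "f * g1 = f1 * g"
      using f f1 by (simp add: eq_fract)
    hence "poly f c * poly g1 c = 0"
      using c by (metis mult_zero_right poly_mult)
    hence "poly f c = 0"
      using f1(2) by simp
    then obtain f' g' where fg': "f = [:-c, 1:] * f'" "g = [:-c, 1:] * g'"
      using c by (meson poly_eq_0_iff_dvd dvdE)
    hence "g' \<noteq> 0" "x = Fract f' g'"
      using f by (auto simp: mult_fract_cancel simp del: mult_pCons_left)
    hence "degree g \<le> degree g'"
      using g_min by blast
    moreover have "degree g = Suc (degree g')"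
      using \<open>g' \<noteq> 0\<close> by (simp add: fg'(2) degree_mult_eq del: mult_pCons_left)
    ultimately show False
      by simp
  qed
  then obtain a where a: "g = [:a:]"
    by (rule degree_eq_zeroE)
  hence "x = to_fract (smult (inverse a) f)"
    using f by (simp add: to_fract_def eq_fract)
  thus ?thesis ..
qed


section \<open>Derivations given by tangent vectors\<close>

text \<open>Evaluation over the dual numbers: the coefficient of \<open>\<epsilon>\<close> is \<open>\<Sum>i. K\<^sub>i \<cdot> (\<partial>\<^sub>i P)(\<phi>)\<close>.\<close>
definition tangent_eval ::
    "(nat \<Rightarrow> 'a::field poly) \<Rightarrow> (nat \<Rightarrow> 'a poly) \<Rightarrow> 'a mpoly \<Rightarrow> 'a poly" where
  "tangent_eval \<phi> K P = coeff (mpoly_eval (\<lambda>c. [:[:c:]:]) (\<lambda>i. [:\<phi> i, K i:]) P) 1"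

lemma coeff_dual_eval_0:
  "coeff (mpoly_eval (\<lambda>c. [:[:c:]:]) (\<lambda>i. [:\<phi> i, K i:]) P) 0 = pullback \<phi> P"
  unfolding coeff0_hom.hom_mpoly_eval by simp

lemma coeff_mult_Suc_0: "coeff (f * g) (Suc 0) = coeff f 0 * coeff g (Suc 0) + coeff f (Suc 0) * coeff g 0"
  by (simp add: coeff_mult)

lemma tangent_eval_add: "tangent_eval \<phi> K (P + Q) = tangent_eval \<phi> K P + tangent_eval \<phi> K Q"
  by (simp add: tangent_eval_def const2_hom.mpoly_eval_add)

lemma tangent_eval_diff: "tangent_eval \<phi> K (P - Q) = tangent_eval \<phi> K P - tangent_eval \<phi> K Q"
  by (simp add: tangent_eval_def const2_hom.mpoly_eval_diff)

lemma tangent_eval_mult: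
  "tangent_eval \<phi> K (P * Q) = pullback \<phi> P * tangent_eval \<phi> K Q + tangent_eval \<phi> K P * pullback \<phi> Q"
  by (simp add: tangent_eval_def const2_hom.mpoly_eval_mult coeff_mult_Suc_0 coeff_dual_eval_0)

lemma tangent_eval_const: "tangent_eval \<phi> K (Poly_Mapping.single 0 c) = 0"
  by (simp add: tangent_eval_def const2_hom.mpoly_eval_single)

lemma tangent_eval_1: "tangent_eval \<phi> K 1 = 0"
  using tangent_eval_const[of \<phi> K 1] by simp

lemma tangent_eval_var: "tangent_eval \<phi> K (mpoly_var i) = K i"
  by (simp add: tangent_eval_def)

lemma coeff_linear_power:
  "coeff ([:a, b:] ^ Suc k) (Suc 0) = of_nat (Suc k) * a ^ k * (b :: 'a::comm_ring_1)"
proof (induction k)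
  case (Suc k)
  have "coeff ([:a, b:] ^ Suc k) 0 = a ^ Suc k"
    using coeff0_hom.hom_power[of "[:a, b:]" "Suc k"] by simp
  thus ?case
    using Suc.IH by (subst power_Suc) (simp add: coeff_mult_Suc_0 algebra_simps del: power_Suc, simp add: algebra_simps)
qed simp

lemma tangent_eval_fermat:
  "tangent_eval \<phi> K (fermat N (Suc k)) = (\<Sum>i<N. of_nat (Suc k) * \<phi> i ^ k * K i)"
  by (simp add: tangent_eval_def const2_hom.mpoly_eval_fermat coeff_sum coeff_linear_power del: power_Suc)

text \<open>The quotient rule for a / b along the vector \<open>K / d\<close>. The denominator
  \<open>d\<close> will be a power of z, invertible on the overlap of the two charts.\<close>

definition quotient_derivation ::
    "(nat \<Rightarrow> 'a::field poly) \<Rightarrow> (nat \<Rightarrow> 'a poly) \<Rightarrow> 'a poly \<Rightarrow> 'a mpoly \<times> 'a mpoly \<Rightarrow> 'a poly fract" where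
  "quotient_derivation \<phi> K d = (\<lambda>(a, b).
     Fract (tangent_eval \<phi> K a * pullback \<phi> b - pullback \<phi> a * tangent_eval \<phi> K b)
       (d * pullback \<phi> b ^ 2))"

text \<open>Independence of the representative comes from tangency: both the pullback and
  \<open>tangent_eval\<close> kill multiples of \<open>F\<close>, and the nonzero pullback of the
  factor \<open>c\<close> in \<open>same_germ\<close> cancels.\<close>

lemma derivation_along_quotient_derivation:
  assumes "pullback \<phi> F = 0" "tangent_eval \<phi> K F = 0" "d \<noteq> 0"
  shows "derivation_along n F \<phi> (quotient_derivation \<phi> K d)"
  unfolding derivation_along_def
proof (intro conjI ballI allI impI)
  fix u w
  assume uw: "u \<in> local_fractions n \<phi>" "w \<in> local_fractions n \<phi>" "same_germ n F \<phi> u w"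
  obtain a b a' b' where eq: "u = (a, b)" "w = (a', b')"
    by fastforce
  have nz: "pullback \<phi> b \<noteq> 0" "pullback \<phi> b' \<noteq> 0"
    using uw by (auto simp: eq local_fractions_def)
  obtain c R where c: "pullback \<phi> c \<noteq> 0" "c * (a * b' - a' * b) = F * R"
    using uw(3) unfolding same_germ_def eq case_prod_conv by (blast elim: dvdE)
  have "pullback \<phi> c * (pullback \<phi> a * pullback \<phi> b' - pullback \<phi> a' * pullback \<phi> b) = 0"
    using arg_cong[OF c(2), of "pullback \<phi>"] assms(1)
    by (simp add: const_hom.mpoly_eval_mult const_hom.mpoly_eval_diff)
  hence 1: "pullback \<phi> a * pullback \<phi> b' - pullback \<phi> a' * pullback \<phi> b = 0"
    using c(1) by simp
  have "pullback \<phi> c * tangent_eval \<phi> K (a * b' - a' * b) = 0"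
    using arg_cong[OF c(2), of "tangent_eval \<phi> K"] assms 1
    by (simp add: tangent_eval_mult const_hom.mpoly_eval_mult const_hom.mpoly_eval_diff)
  hence 2: "pullback \<phi> a * tangent_eval \<phi> K b' + tangent_eval \<phi> K a * pullback \<phi> b' =
      pullback \<phi> a' * tangent_eval \<phi> K b + tangent_eval \<phi> K a' * pullback \<phi> b"
    using c(1) by (simp add: tangent_eval_diff tangent_eval_mult)
  have "(A * B - A0 * C) * (d * B' ^ 2) = (A' * B' - A0' * C') * (d * B ^ 2)"
    if "A0 * B' - A0' * B = 0" "A0 * C' + A * B' = A0' * C + A' * B"
    for A B A0 C A' B' A0' C' :: "'a poly"
    using that by algebra
  thus "quotient_derivation \<phi> K d u = quotient_derivation \<phi> K d w"
    using nz 1 2 assms(3) by (simp add: eq quotient_derivation_def eq_fract)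
next
  fix c
  show "quotient_derivation \<phi> K d (Poly_Mapping.single 0 c, 1) = 0"
    by (simp add: quotient_derivation_def tangent_eval_const tangent_eval_1 fract_collapse)
next
  let ?D = "quotient_derivation \<phi> K d"
  fix u assume u: "u \<in> local_fractions n \<phi>"
  have "?D (a * b' + a' * b, b * b') = ?D (a, b) + ?D (a', b') \<and>
      ?D (a * a', b * b') =
        Fract (pullback \<phi> a) (pullback \<phi> b) * ?D (a', b') +
        Fract (pullback \<phi> a') (pullback \<phi> b') * ?D (a, b)"
    if "u = (a, b)" "(a', b') \<in> local_fractions n \<phi>" for a b a' b'
  proof
    have nz: "pullback \<phi> b \<noteq> 0" "pullback \<phi> b' \<noteq> 0"
      using u that by (auto simp: local_fractions_def)
    show "?D (a * b' + a' * b, b * b') = ?D (a, b) + ?D (a', b')"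
      using nz assms(3)
      by (simp add: quotient_derivation_def eq_fract tangent_eval_add tangent_eval_mult
          const_hom.mpoly_eval_mult const_hom.mpoly_eval_add) algebra
    show "?D (a * a', b * b') =
        Fract (pullback \<phi> a) (pullback \<phi> b) * ?D (a', b') +
        Fract (pullback \<phi> a') (pullback \<phi> b') * ?D (a, b)"
      using nz assms(3)
      by (simp add: quotient_derivation_def eq_fract tangent_eval_mult
          const_hom.mpoly_eval_mult) algebra
  qed
  thus "case u of (a, b) \<Rightarrow> \<forall>(a', b')\<in>local_fractions n \<phi>.
      ?D (a * b' + a' * b, b * b') = ?D (a, b) + ?D (a', b') \<and>
      ?D (a * a', b * b') =
        Fract (pullback \<phi> a) (pullback \<phi> b) * ?D (a', b') +
        Fract (pullback \<phi> a') (pullback \<phi> b') * ?D (a, b)"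
    by (cases u) blast
qed


section \<open>Derivations along a curve on a Fermat hypersurface\<close>

lemma local_fractionsI:
  "a \<in> forms (n + 2) r \<Longrightarrow> b \<in> forms (n + 2) r \<Longrightarrow> pullback \<phi> b \<noteq> 0 \<Longrightarrow>
    (a, b) \<in> local_fractions n \<phi>"
  by (auto simp: local_fractions_def)

lemma local_fraction_vars:
  "i < n + 2 \<Longrightarrow> l < n + 2 \<Longrightarrow> \<phi> l \<noteq> 0 \<Longrightarrow> (mpoly_var i, mpoly_var l) \<in> local_fractions n \<phi>"
  using forms_mpoly_var by (intro local_fractionsI) (auto simp: const_hom.mpoly_eval_var)

context
  fixes n :: nat and F :: "'a::field mpoly" and \<phi> D
  assumes D: "derivation_along n F \<phi> D"
begin

lemma derivation_along_cong:
  assumes "(a, b) \<in> local_fractions n \<phi>" "(a', b') \<in> local_fractions n \<phi>" "F dvd a * b' - a' * b"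
  shows "D (a, b) = D (a', b')"
proof -
  have "same_germ n F \<phi> (a, b) (a', b')"
    unfolding same_germ_def using assms(3)
    by (auto intro!: exI[of _ "0 :: nat"] bexI[of _ 1])
  thus ?thesis
    using D assms(1,2) unfolding derivation_along_def by blast
qed

lemma derivation_along_mult:
  "(a, b) \<in> local_fractions n \<phi> \<Longrightarrow> (a', b') \<in> local_fractions n \<phi> \<Longrightarrow>
    D (a * a', b * b') = Fract (pullback \<phi> a) (pullback \<phi> b) * D (a', b') +
      Fract (pullback \<phi> a') (pullback \<phi> b') * D (a, b)"
  using D unfolding derivation_along_def by fast

lemma derivation_along_0:
  assumes "F dvd a" "(a, b) \<in> local_fractions n \<phi>"
  shows "D (a, b) = 0"
proof -
  have "(0, 1) \<in> local_fractions n \<phi>"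
    by (rule local_fractionsI[of _ _ 0]) simp_all
  hence "D (a, b) = D (0, 1)"
    using assms by (intro derivation_along_cong) auto
  also have "\<dots> = D (Poly_Mapping.single 0 0, 1)"
    by simp
  also have "\<dots> = 0"
    using D unfolding derivation_along_def by blast
  finally show ?thesis .
qed

lemma derivation_along_add:
  assumes "a \<in> forms (n + 2) r" "a' \<in> forms (n + 2) r" "b \<in> forms (n + 2) r" "pullback \<phi> b \<noteq> 0"
  shows "D (a + a', b) = D (a, b) + D (a', b)"
proof -
  have lf: "(a, b) \<in> local_fractions n \<phi>" "(a', b) \<in> local_fractions n \<phi>" "(a + a', b) \<in> local_fractions n \<phi>"
    using assms local_fractionsI forms_add by blast+
  moreover have "(a * b + a' * b, b * b) \<in> local_fractions n \<phi>"
    using assms by (intro local_fractionsI[of _ _ "r + r"] forms_add forms_mult)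
      (auto simp: const_hom.mpoly_eval_mult)
  ultimately have "D (a + a', b) = D (a * b + a' * b, b * b)"
    by (intro derivation_along_cong) (simp_all add: algebra_simps)
  also have "\<dots> = D (a, b) + D (a', b)"
    using D lf unfolding derivation_along_def by fast
  finally show ?thesis .
qed

lemma derivation_along_sum:
  assumes "finite A" "\<And>i. i \<in> A \<Longrightarrow> a i \<in> forms (n + 2) r" "b \<in> forms (n + 2) r" "pullback \<phi> b \<noteq> 0"
  shows "D (\<Sum>i\<in>A. a i, b) = (\<Sum>i\<in>A. D (a i, b))"
  using assms(1,2)
proof (induction A rule: finite_induct)
  case empty
  show ?case
    using assms derivation_along_0[OF _ local_fractionsI[OF forms_0 assms(3,4)]] by simp
next
  case (insert i A)
  thus ?case
    using assms by (simp add: derivation_along_add[where r = r] forms_sum)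
qed

text \<open>With \<open>\<delta>\<^sub>i = \<phi>\<^sub>m D(x\<^sub>i/x\<^sub>m)\<close> this is \<open>\<phi>\<^sub>l \<delta>\<^sub>i - \<phi>\<^sub>i \<delta>\<^sub>l = \<phi>\<^sub>l\<^sup>2 D(x\<^sub>i/x\<^sub>l)\<close>.\<close>
lemma derivation_along_change_chart:
  assumes "i < n + 2" "l < n + 2" "m < n + 2" "\<phi> l \<noteq> 0" "\<phi> m \<noteq> 0"
  shows "to_fract (\<phi> l) * (to_fract (\<phi> m) * D (mpoly_var i, mpoly_var m)) -
      to_fract (\<phi> i) * (to_fract (\<phi> m) * D (mpoly_var l, mpoly_var m)) =
      to_fract (\<phi> l) ^ 2 * D (mpoly_var i, mpoly_var l)"
proof -
  let ?x = "mpoly_var :: nat \<Rightarrow> 'a mpoly"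
  have lf: "(?x i * ?x l, ?x l * ?x m) \<in> local_fractions n \<phi>"
    using assms by (intro local_fractionsI[of _ _ "1 + 1"] forms_mult forms_mpoly_var)
      (auto simp: const_hom.mpoly_eval_mult)
  have "D (?x i, ?x m) = D (?x i * ?x l, ?x l * ?x m)"
    using assms lf by (intro derivation_along_cong local_fraction_vars) auto
  also have "\<dots> = Fract (\<phi> i) (\<phi> l) * D (?x l, ?x m) + Fract (\<phi> l) (\<phi> m) * D (?x i, ?x l)"
    using derivation_along_mult[OF local_fraction_vars local_fraction_vars] assms
    by (simp add: const_hom.mpoly_eval_var)
  also have "Fract (\<phi> i) (\<phi> l) = to_fract (\<phi> i) / to_fract (\<phi> l)"
    by (simp add: to_fract_def)
  also have "Fract (\<phi> l) (\<phi> m) = to_fract (\<phi> l) / to_fract (\<phi> m)"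
    by (simp add: to_fract_def)
  finally show ?thesis
    using assms by (simp add: field_simps power2_eq_square)
qed

lemma derivation_along_power:
  assumes "i < n + 2" "l < n + 2" "\<phi> l \<noteq> 0"
  shows "D (mpoly_var i ^ Suc k, mpoly_var l ^ Suc k) =
    of_nat (Suc k) * Fract (\<phi> i ^ k) (\<phi> l ^ k) * D (mpoly_var i, mpoly_var l)"
proof (induction k)
  case 0
  show ?case
    by (simp add: fract_collapse)
next
  case (Suc k)
  let ?x = "mpoly_var :: nat \<Rightarrow> 'a mpoly"
  have lf: "(?x i ^ Suc k, ?x l ^ Suc k) \<in> local_fractions n \<phi>"
    using assms by (intro local_fractionsI[of _ _ "Suc k * 1"] forms_power forms_mpoly_var)
      (auto simp: const_hom.mpoly_eval_power simp del: power_Suc)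
  have "D (?x i ^ Suc (Suc k), ?x l ^ Suc (Suc k)) = D (?x i * ?x i ^ Suc k, ?x l * ?x l ^ Suc k)"
    by simp
  also have "\<dots> = Fract (\<phi> i) (\<phi> l) * D (?x i ^ Suc k, ?x l ^ Suc k) +
      Fract (\<phi> i ^ Suc k) (\<phi> l ^ Suc k) * D (?x i, ?x l)"
    using derivation_along_mult[OF local_fraction_vars[of _ _ _ \<phi>, OF assms] lf]
    by (simp add: const_hom.mpoly_eval_var const_hom.mpoly_eval_power del: power_Suc)
  also have "\<dots> = (of_nat (Suc k) * (Fract (\<phi> i) (\<phi> l) * Fract (\<phi> i ^ k) (\<phi> l ^ k)) +
      Fract (\<phi> i ^ Suc k) (\<phi> l ^ Suc k)) * D (?x i, ?x l)"
    unfolding Suc.IH by (simp only: algebra_simps)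
  also have "Fract (\<phi> i) (\<phi> l) * Fract (\<phi> i ^ k) (\<phi> l ^ k) = Fract (\<phi> i ^ Suc k) (\<phi> l ^ Suc k)"
    by simp
  also have "of_nat (Suc k) * Fract (\<phi> i ^ Suc k) (\<phi> l ^ Suc k) + Fract (\<phi> i ^ Suc k) (\<phi> l ^ Suc k) =
      of_nat (Suc (Suc k)) * Fract (\<phi> i ^ Suc k) (\<phi> l ^ Suc k)"
    by (simp only: of_nat_Suc[of "Suc k"] distrib_right mult_1_left add.commute)
  finally show ?case .
qed

text \<open>Apply \<open>D\<close> to the equation divided by the power \<open>Suc q\<close> of the
  \<open>l\<close>-th coordinate, which is zero in the local ring; the factor q + 1 from the power
  rule is 1.\<close>

lemma derivation_along_fermat:
  assumes F: "F = fermat (n + 2) (q + 1)" and q: "of_nat q = (0 :: 'a)"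
    and l: "l < n + 2" "\<phi> l \<noteq> 0"
  shows "(\<Sum>i<n + 2. to_fract (\<phi> i) ^ q * D (mpoly_var i, mpoly_var l)) = 0"
proof -
  let ?x = "mpoly_var :: nat \<Rightarrow> 'a mpoly"
  have x_forms: "?x i ^ Suc q \<in> forms (n + 2) (Suc q)" if "i < n + 2" for i
    using forms_power[OF forms_mpoly_var[OF that], of "Suc q"] by simp
  have nz: "pullback \<phi> (?x l ^ Suc q) \<noteq> 0"
    using l by (simp add: const_hom.mpoly_eval_power del: power_Suc)
  have "of_nat (Suc q) = (1 :: 'a poly fract)"
    using q by (simp add: of_nat_fract of_nat_poly fract_collapse flip: one_pCons)
  hence "D (?x i ^ Suc q, ?x l ^ Suc q) = Fract (\<phi> i ^ q) (\<phi> l ^ q) * D (?x i, ?x l)"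
    if "i < n + 2" for i
    using derivation_along_power[OF that l, of q] by simp
  moreover have "Fract (\<phi> i ^ q) (\<phi> l ^ q) = to_fract (\<phi> i) ^ q / to_fract (\<phi> l) ^ q" for i
    by (simp flip: to_fract_hom.hom_power) (simp add: to_fract_def)
  ultimately have "to_fract (\<phi> i) ^ q * D (?x i, ?x l) = to_fract (\<phi> l) ^ q * D (?x i ^ Suc q, ?x l ^ Suc q)"
    if "i < n + 2" for i
    using that l(2) by (simp del: power_Suc)
  hence "(\<Sum>i<n + 2. to_fract (\<phi> i) ^ q * D (?x i, ?x l)) =
      to_fract (\<phi> l) ^ q * (\<Sum>i<n + 2. D (?x i ^ Suc q, ?x l ^ Suc q))"
    unfolding sum_distrib_left by (intro sum.cong) auto
  also have "(\<Sum>i<n + 2. D (?x i ^ Suc q, ?x l ^ Suc q)) = D (\<Sum>i<n + 2. ?x i ^ Suc q, ?x l ^ Suc q)"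
    using x_forms l(1) nz by (intro derivation_along_sum[symmetric]) auto
  also have "\<dots> = 0"
    using x_forms l(1) nz by (intro derivation_along_0 local_fractionsI forms_sum) (auto simp: F fermat_def)
  finally show ?thesis
    by simp
qed

end


section \<open>Free rational curves on Fermat hypersurfaces\<close>

lemma form_at_Affine [simp]: "form_at e f (Affine c) = poly f c"
  by (simp add: form_at_def)

lemma mpoly_eval_form_at_Affine:
  "mpoly_eval id (\<lambda>i. form_at e (\<phi> i) (Affine c)) P = poly (pullback \<phi> P) c"
  unfolding poly_hom.hom_mpoly_eval by (simp add: id_def)

lemma tangent_sections_stalk:
  assumes "D \<in> tangent_sections n F e \<phi> m V" "(a, b) \<in> local_fractions n \<phi>" "v \<in> V"
    and "mpoly_eval id (\<lambda>i. form_at e (\<phi> i) v) b \<noteq> 0"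
  shows "D (a, b) \<in> line_bundle_stalk m v"
  using assms unfolding tangent_sections_def by blast

lemma quotient_derivation_tangent_section:
  assumes "pullback \<phi> F = 0" "tangent_eval \<phi> K F = 0"
  shows "quotient_derivation \<phi> K (monom 1 M) \<in>
    tangent_sections n F e \<phi> m (UNIV - {Affine 0, Infinity})"
  unfolding tangent_sections_def
proof (intro CollectI conjI ballI)
  show "derivation_along n F \<phi> (quotient_derivation \<phi> K (monom 1 M))"
    using assms by (rule derivation_along_quotient_derivation) simp
  fix v :: "'a P1" and u assume v: "v \<in> UNIV - {Affine 0, Infinity}"
  then obtain c where c: "v = Affine c" "c \<noteq> 0"
    by (cases v) auto
  have "quotient_derivation \<phi> K (monom 1 M) (a, b) \<in> line_bundle_stalk m v"
    if "mpoly_eval id (\<lambda>i. form_at e (\<phi> i) v) b \<noteq> 0" for a b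
    using that c unfolding c(1) mpoly_eval_form_at_Affine quotient_derivation_def case_prod_conv
    by (intro stalk_AffineI) (simp add: poly_monom)
  thus "case u of (a, b) \<Rightarrow> mpoly_eval id (\<lambda>i. form_at e (\<phi> i) v) b \<noteq> 0 \<longrightarrow>
      quotient_derivation \<phi> K (monom 1 M) (a, b) \<in> line_bundle_stalk m v"
    by (cases u) simp
qed

context frobenius_power
begin

text \<open>
  The extension \<open>0 \<rightarrow> T \<rightarrow> O(e)\<^sup>n\<^sup>+\<^sup>2 \<rightarrow> O((q+1)e) \<rightarrow> 0\<close> given by \<open>(\<phi>\<^sub>i\<^sup>q)\<close> has \<open>T / O\<close> equal to the
  pulled back tangent bundle, so freeness of \<open>\<phi>\<close> says that the map on sections is surjective after
  a twist by \<open>-1\<close>.  A lift of \<open>h\<close> is found by gluing local lifts \<open>g0\<close> and \<open>g1 / z\<^sup>M\<close>; the last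
  step removes the ambiguity by multiples of \<open>\<phi>\<close>, i.e. by \<open>O\<close>.
\<close>
lemma free_fermat_surjective:
  fixes \<phi> :: "nat \<Rightarrow> 'a poly"
  assumes rc: "rational_curve n (fermat (n + 2) (q + 1)) e \<phi>"
    and H1: "tangent_H1_vanishes n (fermat (n + 2) (q + 1)) e \<phi> (-1)"
    and h: "degree_less h ((q + 1) * e)"
  shows "\<exists>g. h = (\<Sum>i<n + 2. g i * \<phi> i ^ q) \<and> (\<forall>i<n + 2. degree_less (g i) e)"
proof -
  note add_2_eq_Suc' [simp del]
  let ?N = "n + 2" and ?F = "fermat (n + 2) (q + 1) :: 'a mpoly"
  let ?x = "mpoly_var :: nat \<Rightarrow> 'a mpoly" and ?f = "\<lambda>i. to_fract (\<phi> i)"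
  have deg: "degree (\<phi> i) \<le> e" if "i < ?N" for i
    using rc that by (simp add: rational_curve_def)
  have no_zero: "\<exists>i<?N. form_at e (\<phi> i) v \<noteq> 0" for v
    using rc by (simp add: rational_curve_def)
  have eqn: "(\<Sum>i<?N. \<phi> i ^ Suc q) = 0"
    using rc by (simp add: rational_curve_def const_hom.mpoly_eval_fermat del: power_Suc)
  obtain u where u: "(\<Sum>i<?N. u i * \<phi> i) = 1"
    using bezout_no_common_zero[of ?N \<phi>] no_zero[of "Affine _"] by auto
  obtain l where l: "l < ?N" "coeff (\<phi> l) e \<noteq> 0"
    using no_zero[of Infinity] by (auto simp: form_at_def)
  have l': "degree (\<phi> l) = e" "\<phi> l \<noteq> 0"
    using l deg[OF l(1)] le_degree[OF l(2)] by auto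
  \<comment> \<open>Frobenius turns the Bezout relation for the \<open>\<phi> i\<close> into one for
    their q-th powers.\<close>
  have uq: "(\<Sum>i<?N. u i ^ q * \<phi> i ^ q) = 1"
    using u by (metis (no_types, lifting) frob_poly_sum power_mult_distrib power_one sum.cong)
  obtain M g1 where g1: "(\<Sum>i<?N. g1 i * \<phi> i ^ q) = monom 1 M * h"
    "\<And>i. i < ?N \<Longrightarrow> degree_less (g1 i) (M + e)"
  proof -
    have "\<exists>M g. (\<Sum>i<?N. g i * \<phi> i ^ q) = monom 1 M * h \<and> (\<forall>i<?N. degree_less (g i) (M + e))"
    proof (rule bezout_at_infinity[where m = "q * e"])
      show "degree (\<phi> i ^ q) \<le> q * e" if "i < ?N" for i
        using deg[OF that] degree_power_le[of "\<phi> i" q] by (metis mult.commute mult_le_mono2 order_trans)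
      show "degree (\<phi> l ^ q) = q * e"
        using l' by (simp add: degree_power_eq)
      show "degree_less h (q * e + e)"
        using h by (simp add: add.commute)
    qed (use l l' uq in auto)
    thus ?thesis
      using that by blast
  qed
  define g0 where "g0 i = h * u i ^ q" for i
  have g0: "(\<Sum>i<?N. g0 i * \<phi> i ^ q) = h"
    using uq by (simp add: g0_def mult.assoc flip: sum_distrib_left)
  \<comment> \<open>\<open>g0\<close> and \<open>g1\<close> over z^M lift \<open>h\<close> on the
    two charts. Their difference on the overlap is \<open>K\<close> over z^M; it is tangent, and
    \<open>D\<close> is the resulting Cech cocycle.\<close>
  define K where "K i = monom 1 M * g0 i - g1 i" for i
  have F0: "pullback \<phi> ?F = 0"
    using eqn by (simp add: const_hom.mpoly_eval_fermat)
  have "of_nat (Suc q) = (1 :: 'a poly)"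
    using of_nat_q by (simp add: of_nat_poly flip: one_pCons)
  hence "tangent_eval \<phi> K ?F = (\<Sum>i<?N. \<phi> i ^ q * K i)"
    by (simp add: tangent_eval_fermat del: of_nat_Suc)
  also have "\<dots> = monom 1 M * (\<Sum>i<?N. g0 i * \<phi> i ^ q) - (\<Sum>i<?N. g1 i * \<phi> i ^ q)"
    unfolding sum_distrib_left sum_subtractf[symmetric]
    by (intro sum.cong) (auto simp: K_def algebra_simps)
  finally have K0: "tangent_eval \<phi> K ?F = 0"
    unfolding g0 g1 by simp
  define D where "D = quotient_derivation \<phi> K (monom 1 M)"
  have "D \<in> tangent_sections n ?F e \<phi> (-1) (UNIV - {Affine 0, Infinity})"
    unfolding D_def using F0 K0 by (rule quotient_derivation_tangent_section)
  then obtain D0 D1 where D0: "D0 \<in> tangent_sections n ?F e \<phi> (-1) (UNIV - {Infinity})"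
    and D1: "D1 \<in> tangent_sections n ?F e \<phi> (-1) (UNIV - {Affine 0})"
    and D01: "\<And>u. u \<in> local_fractions n \<phi> \<Longrightarrow> D u = D0 u - D1 u"
    using H1 unfolding tangent_H1_vanishes_def by blast
  have der: "derivation_along n ?F \<phi> D0"
    using D0 by (simp add: tangent_sections_def)
  have lf: "(?x i, ?x j) \<in> local_fractions n \<phi>" if "i < ?N" "j < ?N" "\<phi> j \<noteq> 0" for i j
    using that by (rule local_fraction_vars)
  define \<delta> where "\<delta> i = ?f l * D0 (?x i, ?x l)" for i
  have chart: "?f j * \<delta> i - ?f i * \<delta> j = ?f j ^ 2 * D0 (?x i, ?x j)"
    if "i < ?N" "j < ?N" "\<phi> j \<noteq> 0" for i j
    unfolding \<delta>_def using derivation_along_change_chart[OF der that(1,2) l(1) that(3) l'(2)] .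
  \<comment> \<open>\<open>\<delta>\<close> lifts \<open>D0\<close> to homogeneous coordinates but
    may have poles where \<open>\<phi> l\<close> vanishes. The antisymmetric expressions are
    regular, and the Bezout coefficients \<open>u\<close> glue them into a lift that differs from
    \<open>\<delta>\<close> by a multiple of \<open>\<phi>\<close>.\<close>
  define L where "L i = (\<Sum>m<?N. to_fract (u m) * (?f m * \<delta> i - ?f i * \<delta> m))" for i
  have u_fract: "(\<Sum>m<?N. to_fract (u m) * ?f m) = 1"
    using u by (metis (no_types, lifting) sum.cong to_fract_1 to_fract_hom.hom_sum to_fract_mult)
  have L: "L i = \<delta> i - ?f i * (\<Sum>m<?N. to_fract (u m) * \<delta> m)" for i
  proof -
    have "L i = (\<Sum>m<?N. to_fract (u m) * ?f m) * \<delta> i - ?f i * (\<Sum>m<?N. to_fract (u m) * \<delta> m)"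
      unfolding L_def sum_distrib_left sum_distrib_right sum_subtractf[symmetric]
      by (intro sum.cong) (auto simp: algebra_simps)
    thus ?thesis
      by (simp add: u_fract)
  qed
  have "\<exists>f. L i = to_fract f" if i: "i < ?N" for i
  proof (rule regular_on_affine_line[where m = "-1"])
    fix c :: 'a
    let ?S = "line_bundle_stalk (-1) (Affine c)"
    obtain j where j: "j < ?N" "poly (\<phi> j) c \<noteq> 0"
      using no_zero[of "Affine c"] by auto
    hence "\<phi> j \<noteq> 0"
      by auto
    have reg: "?f j ^ 2 * D0 (?x k, ?x j) \<in> ?S" if "k < ?N" for k
    proof -
      have "D0 (?x k, ?x j) \<in> ?S"
        by (rule tangent_sections_stalk[OF D0 lf[OF that j(1) \<open>\<phi> j \<noteq> 0\<close>]]) (use j(2) in auto)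
      thus ?thesis
        unfolding power2_eq_square by (intro stalk_Affine_mult stalk_Affine_to_fract)
    qed
    have "?f m * \<delta> i - ?f i * \<delta> m \<in> ?S" if m: "m < ?N" for m
    proof -
      \<comment> \<open>A Pluecker-type identity that passes to a chart \<open>j\<close> with
        \<open>\<phi> j\<close> nonzero at \<open>c\<close>, where \<open>D0\<close> is known to be
        regular.\<close>
      have "?f m * \<delta> i - ?f i * \<delta> m =
          Fract 1 (\<phi> j) * (?f m * (?f j * \<delta> i - ?f i * \<delta> j) - ?f i * (?f j * \<delta> m - ?f m * \<delta> j))"
        using \<open>\<phi> j \<noteq> 0\<close> by (simp add: Fract_conv_to_fract field_simps)
      also have "\<dots> \<in> ?S"
        unfolding chart[OF i j(1) \<open>\<phi> j \<noteq> 0\<close>] chart[OF m j(1) \<open>\<phi> j \<noteq> 0\<close>]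
        by (intro stalk_Affine_mult stalk_Affine_diff stalk_Affine_to_fract reg i m stalk_AffineI j(2))
      finally show ?thesis .
    qed
    thus "L i \<in> ?S"
      unfolding L_def by (intro stalk_Affine_sum stalk_Affine_mult stalk_Affine_to_fract) auto
  qed
  then obtain p where p: "\<And>i. i < ?N \<Longrightarrow> L i = to_fract (p i)"
    by metis
  \<comment> \<open>The part from \<open>\<delta>\<close> vanishes by tangency, and the multiple of
    \<open>\<phi>\<close> by the Fermat equation.\<close>
  have p0: "(\<Sum>i<?N. p i * \<phi> i ^ q) = 0"
  proof -
    have eqn': "(\<Sum>i<?N. ?f i * ?f i ^ q) = 0"
      using arg_cong[OF eqn, of to_fract]
      by (simp add: to_fract_hom.hom_sum to_fract_hom.hom_power)
    have "to_fract (\<Sum>i<?N. p i * \<phi> i ^ q) = (\<Sum>i<?N. L i * ?f i ^ q)"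
      using p by (simp add: to_fract_hom.hom_sum to_fract_hom.hom_power)
    also have "\<dots> = ?f l * (\<Sum>i<?N. ?f i ^ q * D0 (?x i, ?x l)) -
        (\<Sum>m<?N. to_fract (u m) * \<delta> m) * (\<Sum>i<?N. ?f i * ?f i ^ q)"
      unfolding L \<delta>_def sum_distrib_left[of "?f l"] sum_distrib_left[of _ "\<lambda>i. ?f i * ?f i ^ q"]
        sum_subtractf[symmetric]
      by (intro sum.cong) (auto simp: algebra_simps)
    also have "\<dots> = 0"
      using derivation_along_fermat[OF der refl of_nat_q l(1) l'(2)] eqn' by simp
    finally show ?thesis
      by (simp only: to_fract_eq_0_iff)
  qed
  define g' where "g' i = g0 i - p i" for i
  \<comment> \<open>Since \<open>D0 = D + D1\<close>, the terms in \<open>g0\<close> cancel and the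
    expression equals its analogue for \<open>g1\<close> over z^M minus \<open>\<phi> l\<close>
    squared times \<open>D1\<close>. The twist by -1 makes \<open>D1\<close> of negative degree at
    infinity, so both terms have degree < 2e; the estimate is made after multiplying by z^M and the
    denominator of \<open>D1\<close>.\<close>
  have bound: "degree_less (\<phi> l * g' i - \<phi> i * g' l) (e + e)" if i: "i < ?N" for i
  proof -
    let ?X = "\<phi> l * g' i - \<phi> i * g' l" and ?Y = "g1 i * \<phi> l - \<phi> i * g1 l"
    let ?z = "monom (1 :: 'a) M"
    note lf_i = lf[OF i l(1) l'(2)]
    have "D1 (?x i, ?x l) \<in> line_bundle_stalk (-1) Infinity"
      by (rule tangent_sections_stalk[OF D1 lf_i]) (use l(2) in \<open>auto simp: form_at_def\<close>)
    then obtain r s where rs: "D1 (?x i, ?x l) = Fract r s" "s \<noteq> 0" "degree_less r (degree s)"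
      by (auto simp: line_bundle_stalk_def degree_less_iff)
    have "?f l ^ 2 * D (?x i, ?x l) =
        (?f l * to_fract (g0 i) - ?f i * to_fract (g0 l)) - to_fract ?Y / to_fract ?z"
      using l'(2) unfolding D_def quotient_derivation_def case_prod_conv tangent_eval_var
        const_hom.mpoly_eval_var Fract_conv_to_fract K_def
      by (simp add: field_simps power2_eq_square)
    moreover have "to_fract ?X = (?f l * to_fract (g0 i) - ?f i * to_fract (g0 l)) -
        ?f l ^ 2 * D0 (?x i, ?x l)"
      unfolding chart[OF i l(1) l'(2), symmetric]
      using p[OF i] p[OF l(1)] by (simp add: g'_def L algebra_simps)
    moreover have "?f l ^ 2 * D0 (?x i, ?x l) = ?f l ^ 2 * D (?x i, ?x l) + ?f l ^ 2 * Fract r s"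
      using D01[OF lf_i] by (simp add: rs(1) right_diff_distrib)
    ultimately have "to_fract ?X = to_fract ?Y / to_fract ?z - ?f l ^ 2 * Fract r s"
      by (simp only: diff_diff_eq2 diff_add_eq_diff_diff_swap add_diff_cancel_left' diff_diff_eq[symmetric]) simp
    hence "to_fract (?X * (?z * s)) = to_fract (?Y * s - ?z * (\<phi> l * \<phi> l) * r)"
      using rs(2) by (simp add: Fract_conv_to_fract field_simps power2_eq_square)
    hence "?X * (?z * s) = ?Y * s - ?z * (\<phi> l * \<phi> l) * r"
      by (simp only: to_fract_eq_iff)
    also have "degree_less \<dots> (e + e + (M + degree s))"
    proof (rule degree_less_diff)
      have "degree_less ?Y (M + e + e)"
        using degree_less_mult[OF g1(2)[OF i] deg[OF l(1)]] degree_less_mult[OF g1(2)[OF l(1)] deg[OF i]]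
        by (simp add: degree_less_diff mult.commute)
      thus "degree_less (?Y * s) (e + e + (M + degree s))"
        using degree_less_mult[of ?Y "M + e + e" s "degree s"] by (simp add: ac_simps)
      have "degree (?z * (\<phi> l * \<phi> l)) \<le> M + (e + e)"
        using l' by (simp add: degree_mult_eq degree_monom_eq)
      thus "degree_less (?z * (\<phi> l * \<phi> l) * r) (e + e + (M + degree s))"
        using degree_less_mult[OF rs(3), of "?z * (\<phi> l * \<phi> l)" "M + (e + e)"] by (simp add: ac_simps)
    qed
    finally show ?thesis
      by (rule degree_less_mult_cancel) (use rs(2) in \<open>simp_all add: degree_mult_eq degree_monom_eq\<close>)
  qed
  \<comment> \<open>Division leaves a remainder of degree < e in component \<open>l\<close>. The
    bound on the antisymmetric expressions then carries over to all components, because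
    \<open>\<phi> l\<close> has exact degree e.\<close>
  define \<kappa> where "\<kappa> = g' l div \<phi> l"
  define g where "g i = g' i - \<kappa> * \<phi> i" for i
  have "(\<Sum>i<?N. g i * \<phi> i ^ q) =
      (\<Sum>i<?N. g0 i * \<phi> i ^ q) - (\<Sum>i<?N. p i * \<phi> i ^ q) - \<kappa> * (\<Sum>i<?N. \<phi> i ^ Suc q)"
    unfolding sum_distrib_left sum_subtractf[symmetric]
    by (intro sum.cong) (auto simp: g_def g'_def algebra_simps)
  hence "h = (\<Sum>i<?N. g i * \<phi> i ^ q)"
    using g0 p0 eqn by simp
  moreover have "degree_less (g i) e" if i: "i < ?N" for i
  proof (rule degree_less_mult_cancel)
    have gl: "g l = g' l mod \<phi> l"
      by (simp add: g_def \<kappa>_def minus_div_mult_eq_mod)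
    have "degree_less (g l) e"
      using degree_mod_less[OF l'(2), of "g' l"] l'(1) by (auto simp: gl degree_less_iff)
    hence "degree_less (g l * \<phi> i) (e + e)"
      using deg[OF i] by (rule degree_less_mult)
    moreover have "g i * \<phi> l = (\<phi> l * g' i - \<phi> i * g' l) + g l * \<phi> i"
      by (simp add: g_def algebra_simps)
    ultimately show "degree_less (g i * \<phi> l) (e + e)"
      using bound[OF i] by (simp add: degree_less_add)
  qed (use l' in simp_all)
  ultimately show ?thesis
    by blast
qed

section \<open>Degrees of free curves on Fermat hypersurfaces and the limit superior\<close>

lemma free_fermat_degree_bound:
  fixes \<phi> :: "nat \<Rightarrow> 'a poly"
  assumes "free_rational_curve q (fermat (q + 2) (q + 1)) e \<phi>"
  shows "q + 1 \<le> (e div q + 1) * (e div q + 1)"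
proof (rule frobenius_degree_bound)
  have rc: "rational_curve q (fermat (q + 2) (q + 1)) e \<phi>"
    and H1: "tangent_H1_vanishes q (fermat (q + 2) (q + 1)) e \<phi> (-1)"
    using assms by (auto simp: free_rational_curve_def)
  show "degree (\<phi> i) \<le> e" if "i < q + 2" for i
    using rc that by (simp add: rational_curve_def)
  show "(\<Sum>i<q + 2. \<phi> i ^ (q + 1)) = 0"
    using rc by (simp add: rational_curve_def const_hom.mpoly_eval_fermat del: power_Suc)
  show "\<exists>g. h = (\<Sum>i<q + 2. g i * \<phi> i ^ q) \<and> (\<forall>i<q + 2. \<forall>j\<ge>e. coeff (g i) j = 0)"
    if "\<forall>j\<ge>(q + 1) * e. coeff h j = 0" for h
    using free_fermat_surjective[OF rc H1, of h] that by (simp add: degree_less_def)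
  show "e > 0"
  proof (rule Nat.gr0I)
    assume "e = 0"
    have "form_at e (\<phi> i) v = 1 * coeff (\<phi> i) 0" if "i < q + 2" for i v
    proof -
      have "degree (\<phi> i) = 0"
        using rc that \<open>e = 0\<close> by (simp add: rational_curve_def)
      then obtain a where "\<phi> i = [:a:]"
        by (rule degree_eq_zeroE)
      thus ?thesis
        using \<open>e = 0\<close> by (cases v) (auto simp: form_at_def)
    qed
    hence "\<exists>x. \<forall>v. \<exists>c. \<forall>i<q + 2. form_at e (\<phi> i) v = c * x i"
      by (intro exI[of _ "\<lambda>i. coeff (\<phi> i) 0"] allI exI[of _ 1]) simp
    thus False
      using rc by (simp add: rational_curve_def)
  qed
qed

lemma free_degree_bounds_lower:
  assumes "k * k \<le> q"
  shows "ereal (real k - 1) \<le> ereal (1 / real q) *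
    (INF e\<in>free_degree_bounds TYPE('a) q. ereal (real_of_int e))"
proof -
  have "ereal (real q * (real k - 1)) \<le> ereal (real_of_int e)"
    if "e \<in> free_degree_bounds TYPE('a) q" for e
  proof -
    have "smooth_Fano_hypersurface q (fermat (q + 2) (q + 1) :: 'a mpoly)"
      using of_nat_q q_pos by (rule smooth_Fano_fermat)
    then obtain e' \<phi> where e': "free_rational_curve q (fermat (q + 2) (q + 1) :: 'a mpoly) e' \<phi>"
      "int e' \<le> e"
      using \<open>e \<in> _\<close> unfolding free_degree_bounds_def by blast
    have "k < e' div q + 1"
    proof (rule ccontr)
      assume "\<not> ?thesis"
      hence "(e' div q + 1) * (e' div q + 1) \<le> k * k"
        by (intro mult_le_mono) simp_all
      thus False
        using free_fermat_degree_bound[OF e'(1)] assms by simp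
    qed
    hence "q * k \<le> q * (e' div q)"
      by simp
    also have "\<dots> \<le> e'"
      by simp
    finally have "real q * real k \<le> real e'"
      by (metis of_nat_le_iff of_nat_mult)
    thus ?thesis
      using e'(2) by (simp add: algebra_simps)
  qed
  \<comment> \<open>When no bound \<open>e\<close> exists the infimum is infinity, and the estimate
    holds as well.\<close>
  hence "ereal (real q * (real k - 1)) \<le> (INF e\<in>free_degree_bounds TYPE('a) q. ereal (real_of_int e))"
    by (rule INF_greatest)
  hence "ereal (1 / real q) * ereal (real q * (real k - 1)) \<le>
      ereal (1 / real q) * (INF e\<in>free_degree_bounds TYPE('a) q. ereal (real_of_int e))"
    by (rule ereal_mult_left_mono) simp
  thus ?thesis
    using q_pos by simp
qed

end

theorem mainTheorem1:
  fixes p :: nat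
  assumes "CHAR('a::alg_closed_field) = p" and "p > 0"
  shows "limsup (\<lambda>n. ereal (1 / real n) *
           (INF e\<in>free_degree_bounds TYPE('a) n. ereal (real_of_int e))) = \<infinity>"
proof -
  let ?s = "\<lambda>n. ereal (1 / real n) *
           (INF e\<in>free_degree_bounds TYPE('a) n. ereal (real_of_int e))"
  have "p \<ge> 2"
    using assms prime_CHAR_semidom[where 'a = 'a] prime_ge_2_nat by blast
  have large: "ereal (real k - 1) \<le> ?s (p ^ Suc a)" if "k * k \<le> a" for k a
  proof -
    interpret frobenius_power "p ^ Suc a" "TYPE('a)"
      by standard (use assms in auto)
    have "a < 2 ^ a"
      by (rule less_exp)
    also have "2 ^ a \<le> p ^ a"
      using \<open>p \<ge> 2\<close> by (rule power_mono) simp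
    also have "\<dots> \<le> p ^ Suc a"
      using assms(2) by simp
    finally show ?thesis
      using that by (intro free_degree_bounds_lower) simp
  qed
  \<comment> \<open>Dimensions n that are powers of p form a subsequence, and a lower bound along it
    passes to the full limit superior.\<close>
  have "limsup (\<lambda>a. ?s (p ^ Suc a)) \<le> limsup ?s"
    using limsup_subseq_mono[of "\<lambda>a. p ^ Suc a" ?s] \<open>p \<ge> 2\<close>
    by (simp add: o_def strict_mono_Suc_iff)
  moreover have "ereal C \<le> limsup (\<lambda>a. ?s (p ^ Suc a))" for C
  proof -
    define k where "k = nat \<lceil>C\<rceil> + 1"
    have "C \<le> real k - 1"
      unfolding k_def by linarith
    hence "ereal C \<le> ?s (p ^ Suc a)" if "a \<ge> k * k" for a
      using large[OF that] by (metis ereal_less_eq(3) order_trans)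
    thus ?thesis
      by (intro le_Limsup) (auto intro: eventually_sequentiallyI)
  qed
  ultimately have "ereal C \<le> limsup ?s" for C
    by (meson order_trans)
  thus ?thesis
    by (rule ereal_top)
qed

end
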